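(* Let $q,a,b,c,d,e,h$ be non-zero complex numbers with $|q|<1$, let $\sigma\in(0,\infty)$, $z=\mathrm e^{i\psi}$, and suppose $h,\,h\sqrt{\frac ab}\notin\{q^k:k\in\mathbb Z\}$. Assume there are no vanishing denominator factors and that the denominator factors in the integrand have maximum modulus less than unity, i.e. $\big|\sigma\sqrt{\frac ab}\big|$, $\big|\sigma\sqrt{\frac ba}\big|$ and $|\gamma|/\sigma$ are $<1$ for each $\gamma\in\big\{\pm q\sqrt b,\sqrt{ab},c\sqrt{\frac ba},d\sqrt{\frac ba},e\sqrt{\frac ba},\frac{b^{3/2}}{\sqrt a},\frac{qa^{3/2}}{cde\sqrt b}\big\}$. Then $$\int_{-\pi}^{\pi}\frac{\left(\big(h\sqrt{\frac ab},\frac qh\sqrt{\frac ba}\big)\frac\sigma z,\ \big(h\sqrt{\frac ab},\frac qh\sqrt{\frac ba},\pm\sqrt b,\frac qc\sqrt{ab},\frac qd\sqrt{ab},\frac qe\sqrt{ab},\big(\frac ba\big)^{3/2}cde\big)\frac z\sigma;q\right)_\infty}{\left(\big(\sqrt{\frac ab},\sqrt{\frac ba}\big)\frac\sigma z,\ \big(\pm q\sqrt b,\sqrt{ab},c\sqrt{\frac ba},d\sqrt{\frac ba},e\sqrt{\frac ba},\frac{b^{3/2}}{\sqrt a},\frac{qa^{3/2}}{cde\sqrt b}\big)\frac z\sigma;q\right)_\infty}\,\mathrm d\psi$$ $$=2\pi\,\frac{\vartheta(h,h\frac ab;q)\,(\frac{qa}c,\frac{qa}{cd},\frac{qa}{c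e},\frac{qa}{de},\frac{bcd}a,\frac{bce}a,\frac{bde}a;q)_\infty}{(q,\frac{qa}c,\frac{bc}a,\frac{bd}a,\frac{be}a,b,c,d,e,\frac{qa}{cde},\frac{qa^2}{bcde};q)_\infty}.$$
   Context: Notation. $(a;q)_\infty=\prod_{j\ge0}(1-aq^j)$, $(a_1,\dots,a_r;q)_\infty=\prod_j(a_j;q)_\infty$. In a list, $\pm x$ stands for the two entries $x,-x$, and $(x_1,\dots,x_k)t$ stands for the entries $x_1t,\dots,x_kt$. The symbol $e$ is a parameter, not Euler's number (written $\mathrm e$). $\vartheta(x;q)=(x,q/x;q)_\infty$ for $x\ne0$, $\vartheta(x_1,\dots,x_k;q)=\prod_j\vartheta(x_j;q)$. Fix square roots $\sqrt a,\sqrt b$ and define all half-integer powers of monomials in $a,b$ multiplicatively from these. Convention "no vanishing denominator factors": every infinite $q$-shifted factorial appearing in a denominator is non-zero. *)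

theory Defs
  imports "HOL-Analysis.Analysis"
begin

text \<open>
  The infinite \<open>q\<close>-shifted factorial. For norm \<open>q < 1\<close> the product converges in the sense of
  \<open>has_prod\<close>, which permits finitely many vanishing factors, so that \<open>qpoch_inf (q powi -n) q = 0\<close>.
\<close>
definition qpoch_inf :: "complex \<Rightarrow> complex \<Rightarrow> complex" where
  "qpoch_inf a q = (\<Prod>j. 1 - a * q ^ j)"

definition qpochs_inf :: "complex list \<Rightarrow> complex \<Rightarrow> complex" where
  "qpochs_inf xs q = prod_list (map (\<lambda>x. qpoch_inf x q) xs)"

definition qtheta :: "complex \<Rightarrow> complex \<Rightarrow> complex" where
  "qtheta x q = qpochs_inf [x, q / x] q"

definition qthetas :: "complex list \<Rightarrow> complex \<Rightarrow> complex" where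
  "qthetas xs q = prod_list (map (\<lambda>x. qtheta x q) xs)"

text \<open>The list notation \<open>(x\<^sub>1, \<dots>, x\<^sub>k) t\<close> for \<open>x\<^sub>1 t, \<dots>, x\<^sub>k t\<close>.\<close>
definition scaled :: "complex list \<Rightarrow> complex \<Rightarrow> complex list" where
  "scaled xs t = map (\<lambda>x. x * t) xs"

end

theory Submission
  imports Defs "HOL-Complex_Analysis.Complex_Analysis"
begin

text \<open>
  Write \<open>\<alpha> = ra / rb\<close>, \<open>x = h \<alpha>\<close>, \<open>t\<^sub>3, t\<^sub>4, t\<^sub>5 = c/\<alpha>, d/\<alpha>, e/\<alpha>\<close>, \<open>u = q b / (t\<^sub>3 t\<^sub>4 t\<^sub>5)\<close> and
  \<open>w = z / \<sigma>\<close>. The integrand becomes a function of \<open>w\<close> on the circle of radius \<open>1 / \<sigma>\<close>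
  (\<open>jackson_kernel\<close>): the theta product \<open>\<theta>(x w) \<theta>(x / w)\<close>, divided by \<open>(\<alpha>/w, 1/(\<alpha> w); q)\<^sub>\<infinity>\<close>, whose zeros lie
  inside the circle, and multiplied by a very-well-poised factor whose poles lie outside. Summing residues
  inside would turn the claim into Bailey's nonterminating extension of Jackson's sum of a terminating
  \<open>\<^sub>8\<phi>\<^sub>7\<close> series. The proof here avoids residues; it evaluates the integral by \<open>q\<close>-difference equations
  in the parameters.

  If \<open>A f - B g = G(w) - G(q w)\<close> on the circle, for constants \<open>A, B\<close> and a function \<open>G\<close> that is analytic
  between the circle and its image under \<open>w \<mapsto> q w\<close>, then \<open>A \<integral> f = B \<integral> g\<close>
  (\<open>circle_integral_q_telescope\<close>). Such a \<open>G\<close> exists for \<open>f\<close> the integrand and \<open>g\<close> the integrand with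
  \<open>(b, u)\<close> replaced by \<open>(q b, q u)\<close>, and \<open>A / B\<close> is the quotient of the right-hand sides. Hence the
  quotient of the two sides of the theorem is invariant under \<open>u \<mapsto> q u\<close>. It is continuous at \<open>u = 0\<close>,
  so it equals its value there (\<open>circle_integral_jackson_to_saalschuetz\<close>). At \<open>u = 0\<close> the integral is a
  nonterminating \<open>q\<close>-Saalschuetz integral, in which the same argument removes \<open>t\<^sub>5\<close>, then \<open>t\<^sub>4\<close>, then
  \<open>t\<^sub>3\<close> (\<open>circle_integral_saalschuetz\<close>).

  What remains is the integral of \<open>\<theta>(x w) \<theta>(x / w) / (\<alpha>/w, 1/(\<alpha> w); q)\<^sub>\<infinity>\<close>. To compute it, one reinserts two
  parameters \<open>t\<^sub>3 = x\<close>, \<open>t\<^sub>4 = q / x\<close>: they cancel half of the theta product, the integrand becomes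
  analytic outside the circle, and the integral is \<open>2 \<pi>\<close> times its value at infinity. These parameters are
  admissible only for \<open>x\<close> in a certain annulus and \<open>\<alpha>\<close> close to the unit circle; analytic continuation
  in \<open>x\<close> and then in \<open>\<alpha>\<close> gives the general case (\<open>circle_integral_theta\<close>).
\<close>

section \<open>Integrals over circles around the origin\<close>

text \<open>
  The circle has radius \<open>norm w\<close> and is parametrised by the angle from \<open>w\<close>. Keeping the starting point
  \<open>w\<close> complex lets the substitution \<open>w \<mapsto> q w\<close> act directly on it.
\<close>

definition circle_integral :: "(complex \<Rightarrow> complex) \<Rightarrow> complex \<Rightarrow> complex" where
  "circle_integral f w = integral {-pi..pi} (\<lambda>\<psi>. f (w * cis \<psi>))"

lemma continuous_on_circle_integral:
  assumes "continuous_on (U \<times> {-pi..pi}) (\<lambda>(x, \<psi>). f x (g x * cis \<psi>))"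
  shows "continuous_on U (\<lambda>x. circle_integral (f x) (g x))"
  using integral_continuous_on_param[of U "-pi" pi "\<lambda>x \<psi>. f x (g x * cis \<psi>)"] assms
  by (simp add: circle_integral_def)

text \<open>
  The Leibniz rule needs a convex domain; holomorphy is local, so balls inside an arbitrary open set
  suffice.
\<close>

lemma holomorphic_on_integral_param:
  fixes f f' :: "complex \<Rightarrow> real \<Rightarrow> complex"
  assumes "open U"
    and der: "\<And>x t. x \<in> U \<Longrightarrow> t \<in> {a..b} \<Longrightarrow> ((\<lambda>x. f x t) has_field_derivative f' x t) (at x)"
    and cont: "continuous_on (U \<times> {a..b}) (\<lambda>(x, t). f x t)"
    and cont': "continuous_on (U \<times> {a..b}) (\<lambda>(x, t). f' x t)"
  shows "(\<lambda>x. integral {a..b} (f x)) holomorphic_on U"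
proof -
  have "(\<lambda>x. integral {a..b} (f x)) field_differentiable (at x0)" if x0: "x0 \<in> U" for x0
  proof -
    obtain e where e: "e > 0" "ball x0 e \<subseteq> U"
      using \<open>open U\<close> x0 openE by blast
    have "(\<lambda>x. integral (cbox a b) (f x)) holomorphic_on ball x0 e"
    proof (rule leibniz_rule_holomorphic)
      show "((\<lambda>x. f x t) has_field_derivative f' x t) (at x within ball x0 e)"
        if "x \<in> ball x0 e" "t \<in> cbox a b" for x t
        by (rule has_field_derivative_at_within[OF der]) (use that e in auto)
      show "f x integrable_on cbox a b" if "x \<in> ball x0 e" for x
      proof (rule integrable_continuous)
        have "continuous_on (cbox a b) (\<lambda>t. (\<lambda>(x, t). f x t) (x, t))"
          by (rule continuous_on_compose2[OF cont]) (use that e in \<open>auto intro!: continuous_intros\<close>)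
        then show "continuous_on (cbox a b) (f x)" by simp
      qed
      show "continuous_on (ball x0 e \<times> cbox a b) (\<lambda>(x, t). f' x t)"
        by (rule continuous_on_subset[OF cont']) (use e in auto)
    qed auto
    then show ?thesis
      using e by (auto simp: holomorphic_on_open field_differentiable_def)
  qed
  then show ?thesis
    by (simp add: holomorphic_on_def field_differentiable_at_within)
qed

text \<open>
  In the coordinate \<open>w = exp s\<close> the annulus becomes a strip, which is convex, and the integral becomes a
  holomorphic function of \<open>s\<close>. Its derivative is the integral of a \<open>\<psi>\<close>-derivative of a \<open>2\<pi>\<close>-periodic
  function, hence zero. The strip absorbs both the change of radius and the rotation of the base point.
\<close>

lemma circle_integral_eq_on_annulus:
  assumes r: "0 < r1" and f: "f holomorphic_on {w. r1 < norm w \<and> norm w < r2}"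
    and w0: "r1 < norm w0" "norm w0 < r2" and w1: "r1 < norm w1" "norm w1 < r2"
  shows "circle_integral f w0 = circle_integral f w1"
proof -
  define A where "A = {w :: complex. r1 < norm w \<and> norm w < r2}"
  define U where "U = {s. ln r1 < Re s} \<inter> {s. Re s < ln r2}"
  have r2: "0 < r2" using r w0 by linarith
  have "open A" unfolding A_def by (intro open_Collect_conj open_Collect_less continuous_intros)
  have fA: "f holomorphic_on A" using f by (simp only: A_def)
  have exp_U: "exp s * cis t \<in> A" if "s \<in> U" for s t
  proof -
    have "r1 < exp (Re s)" "exp (Re s) < r2"
      using that r r2 exp_less_mono[of "ln r1" "Re s"] exp_less_mono[of "Re s" "ln r2"]
      by (auto simp: U_def)
    then show ?thesis by (simp add: A_def norm_mult)
  qed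
  have df: "(f has_field_derivative deriv f w) (at w)" if "w \<in> A" for w
    using holomorphic_derivI[OF fA \<open>open A\<close> that] .
  have cf: "continuous_on A f" and cdf: "continuous_on A (deriv f)"
    by (rule holomorphic_on_imp_continuous_on[OF fA],
        rule holomorphic_on_imp_continuous_on[OF holomorphic_deriv[OF fA \<open>open A\<close>]])
  have "\<exists>c. \<forall>s\<in>U. integral (cbox (-pi) pi) (\<lambda>t. f (exp s * cis t)) = c"
  proof (rule has_field_derivative_zero_constant)
    show cU: "convex U" unfolding U_def
      by (intro convex_Int convex_halfspace_Re_gt convex_halfspace_Re_lt)
    fix s assume s: "s \<in> U"
    have "((\<lambda>s. integral (cbox (-pi) pi) (\<lambda>t. f (exp s * cis t))) has_field_derivative
            integral (cbox (-pi) pi) (\<lambda>t. deriv f (exp s * cis t) * (exp s * cis t))) (at s within U)"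
    proof (rule leibniz_rule_field_derivative[OF _ _ _ s cU])
      show "((\<lambda>s. f (exp s * cis t)) has_field_derivative
              deriv f (exp s * cis t) * (exp s * cis t)) (at s within U)"
        if "s \<in> U" for s t
        by (rule DERIV_chain2[where g = "\<lambda>s. exp s * cis t", OF df[OF exp_U[OF that]]])
           (auto intro!: derivative_eq_intros)
      show "(\<lambda>t. f (exp s * cis t)) integrable_on cbox (-pi) pi" if "s \<in> U" for s
        by (intro integrable_continuous continuous_on_compose2[OF cf] continuous_intros)
           (use exp_U[OF that] in auto)
      show "continuous_on (U \<times> cbox (-pi) pi)
              (\<lambda>(s, t). deriv f (exp s * cis t) * (exp s * cis t))"
        unfolding split_def
        by (intro continuous_intros continuous_on_compose2[OF cdf]) (use exp_U in auto)
    qed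
    moreover have "((\<lambda>t. \<i> * (deriv f (exp s * cis t) * (exp s * cis t))) has_integral
                     f (exp s * cis pi) - f (exp s * cis (-pi))) {-pi..pi}"
    proof (rule fundamental_theorem_of_calculus)
      fix t :: real
      have "((\<lambda>t. exp s * cis t) has_vector_derivative exp s * (\<i> * cis t)) (at t within {-pi..pi})"
        unfolding cis_conv_exp
        by (rule has_vector_derivative_real_field) (auto intro!: derivative_eq_intros)
      from field_vector_diff_chain_within[OF this has_field_derivative_at_within[OF df[OF exp_U[OF s]]]]
      show "((\<lambda>t. f (exp s * cis t)) has_vector_derivative
              \<i> * (deriv f (exp s * cis t) * (exp s * cis t))) (at t within {-pi..pi})"
        by (simp add: o_def mult_ac)
    qed auto
    then have "((\<lambda>t. \<i> * (deriv f (exp s * cis t) * (exp s * cis t))) has_integral 0) {-pi..pi}"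
      by (simp flip: cis_inverse)
    then have "integral (cbox (-pi) pi) (\<lambda>t. deriv f (exp s * cis t) * (exp s * cis t)) = 0"
      using has_integral_mult_right[of "\<lambda>t. \<i> * (deriv f (exp s * cis t) * (exp s * cis t))" 0 "{-pi..pi}" "-\<i>"]
      by (simp add: integral_unique)
    ultimately show "((\<lambda>s. integral (cbox (-pi) pi) (\<lambda>t. f (exp s * cis t))) has_field_derivative 0)
                      (at s within U)"
      by simp
  qed
  then obtain c where c: "\<And>s. s \<in> U \<Longrightarrow> circle_integral f (exp s) = c"
    by (auto simp: circle_integral_def)
  have "circle_integral f w = c" if "r1 < norm w" "norm w < r2" for w
  proof -
    have w: "w \<noteq> 0" using that r by auto
    then have "Ln w \<in> U" using that r r2 by (auto simp: U_def)
    from c[OF this] w show ?thesis by simp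
  qed
  then show ?thesis using w0 w1 by simp
qed

text \<open>
  The orbit \<open>q ^ n * x\<close> tends to \<open>0\<close> while \<open>f\<close> is constant along it. This replaces infinite iteration of
  the \<open>q\<close>-difference equations below.
\<close>

lemma eq_at_zero_if_invariant_under_contraction:
  fixes f :: "complex \<Rightarrow> complex"
  assumes q: "norm q < 1" and U: "open U" "0 \<in> U" "\<And>x. x \<in> U \<Longrightarrow> q * x \<in> U"
    and inv: "\<And>x. x \<in> U \<Longrightarrow> f (q * x) = f x"
    and cont: "continuous_on U f" and x: "x \<in> U"
  shows "f x = f 0"
proof -
  have step: "q ^ n * x \<in> U \<and> f (q ^ n * x) = f x" for n
  proof (induction n)
    case (Suc n)
    with U(3)[of "q ^ n * x"] inv[of "q ^ n * x"] show ?case by (simp add: mult.assoc)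
  qed (use x in auto)
  have lim: "(\<lambda>n. q ^ n * x) \<longlonglongrightarrow> 0"
    using tendsto_mult_left_zero[OF LIMSEQ_power_zero[OF q]] by blast
  have "isCont f 0"
    using cont U(1,2) by (simp add: continuous_on_eq_continuous_at)
  from isCont_tendsto_compose[OF this lim]
  have "(\<lambda>n. f (q ^ n * x)) \<longlonglongrightarrow> f 0" .
  then show ?thesis using step by (simp add: LIMSEQ_const_iff)
qed

text \<open>
  Shrinking the circle by a factor \<open>1/2\<close> leaves the integral unchanged, and the integral depends
  continuously on the radius down to radius \<open>0\<close>.
\<close>

lemma circle_integral_eq_value_at_zero:
  assumes f: "f holomorphic_on ball 0 r" and w: "norm w < r"
  shows "circle_integral f w = 2 * of_real pi * f 0"
proof -
  have "circle_integral f w = circle_integral f 0"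
  proof (rule eq_at_zero_if_invariant_under_contraction[where q = "1/2" and U = "ball 0 r"])
    have "continuous_on (ball 0 r) f" using f by (rule holomorphic_on_imp_continuous_on)
    then have "continuous_on (ball 0 r \<times> {-pi..pi}) (\<lambda>(x, \<psi>). f (x * cis \<psi>))"
      unfolding split_def
      by (rule continuous_on_compose2) (auto simp: norm_mult intro!: continuous_intros)
    then show "continuous_on (ball 0 r) (circle_integral f)"
      by (rule continuous_on_circle_integral[of "ball 0 r" "\<lambda>_. f" "\<lambda>x. x"])
    show "circle_integral f (1 / 2 * x) = circle_integral f x" if "x \<in> ball 0 r" for x
    proof (cases "x = 0")
      case False
      show ?thesis
        by (rule circle_integral_eq_on_annulus[where ?r1.0 = "norm x / 4" and ?r2.0 = r])
           (use False that norm_ge_zero[of x] in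
              \<open>auto simp: norm_mult simp del: norm_ge_zero intro!: holomorphic_on_subset[OF f]\<close>)
    qed auto
  qed (use w le_less_trans[OF norm_ge_zero w] in auto)
  then show ?thesis by (simp add: circle_integral_def algebra_simps scaleR_conv_of_real)
qed

lemma circle_integral_reciprocal: "circle_integral (\<lambda>w. f (1 / w)) w0 = circle_integral f (1 / w0)"
proof -
  have "1 / (w0 * cis \<psi>) = 1 / w0 * cis (- \<psi>)" for \<psi>
    by (simp add: divide_inverse flip: cis_inverse)
  then show ?thesis
    unfolding circle_integral_def using Henstock_Kurzweil_Integration.integral_reflect_real[of pi "-pi" "\<lambda>\<psi>. f (1 / w0 * cis \<psi>)"]
    by (simp only: minus_minus)
qed

section \<open>Infinite q-shifted factorials and theta functions\<close>

locale q_in_unit_disc =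
  fixes q :: complex
  assumes q0: "q \<noteq> 0" and q1: "norm q < 1"
begin

abbreviation P :: "complex \<Rightarrow> complex" where "P a \<equiv> qpoch_inf a q"
abbreviation th :: "complex \<Rightarrow> complex" where "th a \<equiv> qtheta a q"

lemma convergent_prod_P: "convergent_prod (\<lambda>j. 1 - a * q ^ j)"
proof -
  have "summable (\<lambda>j. norm ((1 - a * q ^ j) - 1))"
    using q1 by (simp add: norm_mult norm_power summable_mult)
  then show ?thesis
    using abs_convergent_prod_conv_summable abs_convergent_prod_imp_convergent_prod by blast
qed

lemma P_LIMSEQ: "(\<lambda>n. \<Prod>j<n. 1 - a * q ^ j) \<longlonglongrightarrow> P a"
proof -
  have "(\<lambda>n. \<Prod>j<Suc n. 1 - a * q ^ j) \<longlonglongrightarrow> P a"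
    using convergent_prod_LIMSEQ[OF convergent_prod_P] unfolding lessThan_Suc_atMost qpoch_inf_def .
  then show ?thesis by (rule LIMSEQ_imp_Suc)
qed

lemma P_eq_mult_P_q: "P a = (1 - a) * P (q * a)"
proof (rule LIMSEQ_unique)
  show "(\<lambda>n. \<Prod>j<Suc n. 1 - a * q ^ j) \<longlonglongrightarrow> P a"
    by (rule LIMSEQ_Suc[OF P_LIMSEQ])
  show "(\<lambda>n. \<Prod>j<Suc n. 1 - a * q ^ j) \<longlonglongrightarrow> (1 - a) * P (q * a)"
    unfolding prod.lessThan_Suc_shift using tendsto_mult_left[OF P_LIMSEQ[of "q * a"], of "1 - a"]
    by (simp add: mult_ac)
qed

lemma P_zero [simp]: "P 0 = 1"
  by (simp add: qpoch_inf_def)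

lemma P_nonzero: "norm a < 1 \<Longrightarrow> P a \<noteq> 0"
  unfolding qpoch_inf_def
proof (rule prodinf_nonzero[OF convergent_prod_P])
  fix i assume "norm a < 1"
  then have "norm a * norm q ^ i < 1"
    using q1 power_le_one[of "norm q" i] mult_left_le[of "norm q ^ i" "norm a"] by simp
  then have "norm (a * q ^ i) < 1" by (simp add: norm_mult norm_power)
  then show "1 - a * q ^ i \<noteq> 0" by (metis norm_one order_less_irrefl right_minus_eq)
qed

lemma holomorphic_P: "P holomorphic_on UNIV"
proof (rule holomorphic_uniform_sequence)
  fix x :: complex
  have "uniformly_convergent_on (cball x 1) (\<lambda>n a. \<Prod>j<n. 1 - a * q ^ j)"
  proof (rule uniformly_convergent_on_prod')
    show "uniformly_convergent_on (cball x 1) (\<lambda>N a. \<Sum>n<N. norm (1 - a * q ^ n - 1))"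
    proof (rule Weierstrass_m_test')
      show "norm (norm (1 - a * q ^ n - 1)) \<le> (norm x + 1) * norm q ^ n"
        if "a \<in> cball x 1" for n a
      proof -
        from that have "norm a \<le> norm x + 1"
          using norm_triangle_ineq[of x "a - x"] by (simp add: dist_norm norm_minus_commute)
        then show "norm (norm (1 - a * q ^ n - 1)) \<le> (norm x + 1) * norm q ^ n"
          by (simp add: norm_mult norm_power mult_right_mono)
      qed
      show "summable (\<lambda>n. (norm x + 1) * norm q ^ n)"
        using q1 by (intro summable_mult summable_geometric) simp
    qed
  qed (auto intro!: continuous_intros)
  then obtain l where l: "uniform_limit (cball x 1) (\<lambda>n a. \<Prod>j<n. 1 - a * q ^ j) l sequentially"
    by (auto simp: uniformly_convergent_on_def)
  moreover have "l a = P a" if "a \<in> cball x 1" for a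
    using tendsto_uniform_limitI[OF l that] P_LIMSEQ LIMSEQ_unique by blast
  ultimately have "uniform_limit (cball x 1) (\<lambda>n a. \<Prod>j<n. 1 - a * q ^ j) P sequentially"
    using uniform_limit_cong'[of "cball x 1" "\<lambda>n a. \<Prod>j<n. 1 - a * q ^ j"
        "\<lambda>n a. \<Prod>j<n. 1 - a * q ^ j" l P] by blast
  then show "\<exists>d>0. cball x d \<subseteq> UNIV \<and>
      uniform_limit (cball x d) (\<lambda>n a. \<Prod>j<n. 1 - a * q ^ j) P sequentially"
    by (intro exI[of _ 1]) simp
qed (auto intro!: holomorphic_intros)

lemma holomorphic_on_P [holomorphic_intros]:
  "f holomorphic_on S \<Longrightarrow> (\<lambda>x. P (f x)) holomorphic_on S"
  using holomorphic_on_compose_gen[OF _ holomorphic_P, of f S] by (simp add: o_def)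

lemma continuous_on_P [continuous_intros]:
  "continuous_on S f \<Longrightarrow> continuous_on S (\<lambda>x. P (f x))"
  using continuous_on_compose2[OF holomorphic_on_imp_continuous_on[OF holomorphic_P], of S f]
  by simp

lemma th_eq: "th y = P y * P (q / y)"
  by (simp add: qtheta_def qpochs_inf_def)

lemma th_mult_q:
  assumes "y \<noteq> 0"
  shows "th (q * y) = - th y / y"
proof -
  have "q / (q * y) = 1 / y" "q * (1 / y) = q / y"
    using q0 by simp_all
  then have "th (q * y) = P (q * y) * ((1 - 1 / y) * P (q / y))"
    unfolding th_eq by (metis P_eq_mult_P_q)
  also have "\<dots> = - ((1 - y) * P (q * y) * P (q / y)) / y"
    using assms by (simp add: field_simps)
  finally show ?thesis
    unfolding th_eq P_eq_mult_P_q[of y] .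
qed

lemma th_divide_q:
  assumes "y \<noteq> 0"
  shows "th (y / q) = - (y / q) * th y"
proof -
  have "q * (y / q) = y" using q0 by simp
  with th_mult_q[of "y / q"] assms q0 show ?thesis by simp
qed

lemma holomorphic_on_th [holomorphic_intros]:
  assumes "f holomorphic_on S" "\<And>x. x \<in> S \<Longrightarrow> f x \<noteq> 0"
  shows "(\<lambda>x. th (f x)) holomorphic_on S"
  unfolding th_eq by (intro holomorphic_intros assms ballI)

lemma continuous_on_th [continuous_intros]:
  assumes "continuous_on S f" "\<And>x. x \<in> S \<Longrightarrow> f x \<noteq> 0"
  shows "continuous_on S (\<lambda>x. th (f x))"
  unfolding th_eq by (intro continuous_intros assms ballI)

text \<open>
  The quasi-periodicity factors of the two theta functions combine to one that is free of \<open>x\<close>, so the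
  \<open>q\<close>-difference equations below have coefficients that do not involve \<open>x\<close>.
\<close>

lemma th_product_shift:
  assumes "x \<noteq> 0" "w \<noteq> 0"
  shows "th (x * (q * w)) * th (x / (q * w)) = th (x * w) * th (x / w) / (q * w\<^sup>2)"
proof -
  have "th (x * (q * w)) = - th (x * w) / (x * w)"
    using th_mult_q[of "x * w"] assms by (simp add: mult_ac)
  moreover have "th (x / (q * w)) = - (x / w / q) * th (x / w)"
    using th_divide_q[of "x / w"] assms by (simp add: mult_ac)
  ultimately show ?thesis using assms q0 by (simp add: power2_eq_square)
qed

section \<open>Shifting a parameter by a telescoping difference\<close>

text \<open>
  Replacing \<open>w\<close> by \<open>q * w\<close> moves the circle inside the annulus where \<open>h\<close> is holomorphic, so the
  difference \<open>h w - h (q * w)\<close> integrates to zero.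
\<close>

lemma circle_integral_q_telescope:
  assumes "0 < r1" and h: "h holomorphic_on {w. r1 < norm w \<and> norm w < r2}"
    and r1: "r1 < norm (q * w0)" and r2: "norm w0 < r2"
    and f: "continuous_on (sphere 0 (norm w0)) f" and g: "continuous_on (sphere 0 (norm w0)) g"
    and eq: "\<And>w. norm w = norm w0 \<Longrightarrow> A * f w - B * g w = h w - h (q * w)"
  shows "A * circle_integral f w0 = B * circle_integral g w0"
proof -
  have qw0: "norm (q * w0) \<le> norm w0"
    using q1 by (simp add: norm_mult mult_left_le_one_le)
  have int: "(\<lambda>\<psi>. k (v * cis \<psi>)) integrable_on {-pi..pi}"
    if "continuous_on (sphere 0 (norm v)) k" for k :: "complex \<Rightarrow> complex" and v
    by (rule integrable_continuous_real, rule continuous_on_compose2[OF that])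
       (auto simp: norm_mult intro!: continuous_intros)
  have h_cont: "continuous_on (sphere 0 (norm v)) h" if "r1 < norm v" "norm v < r2" for v
    using that by (intro continuous_on_subset[OF holomorphic_on_imp_continuous_on[OF h]]) auto
  have "A * circle_integral f w0 - B * circle_integral g w0 = integral {-pi..pi} (\<lambda>\<psi>. A * f (w0 * cis \<psi>) - B * g (w0 * cis \<psi>))"
    unfolding circle_integral_def using int[OF f] int[OF g]
    by (subst integral_diff) (auto intro: integrable_on_mult_right)
  also have "\<dots> = integral {-pi..pi} (\<lambda>\<psi>. h (w0 * cis \<psi>) - h (q * w0 * cis \<psi>))"
    using eq[of "w0 * cis _"] by (simp add: norm_mult mult.assoc)
  also have "\<dots> = circle_integral h w0 - circle_integral h (q * w0)"
    unfolding circle_integral_def using r1 r2 qw0 by (intro integral_diff int h_cont) auto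
  also have "circle_integral h w0 = circle_integral h (q * w0)"
    using r1 r2 qw0 by (intro circle_integral_eq_on_annulus[OF \<open>0 < r1\<close> h]) auto
  finally show ?thesis by simp
qed

text \<open>
  Strict inequalities on the circle persist on a slightly larger one; this supplies the outer radius of
  the annuli of holomorphy.
\<close>

lemma ex_larger_radius:
  assumes "finite T" "\<And>t. t \<in> T \<Longrightarrow> norm t * r < (1 :: real)"
  shows "\<exists>r2>r. \<forall>t\<in>T. norm t * r2 < 1"
proof -
  have "\<forall>\<^sub>F s in at_right r. norm t * s < 1" if "t \<in> T" for t
    using assms(2)[OF that] by (intro order_tendstoD(2)[of _ "norm t * r"] tendsto_intros)
  then have "\<forall>\<^sub>F s in at_right r. r < s \<and> (\<forall>t\<in>T. norm t * s < 1)"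
    using assms(1) by (intro eventually_conj eventually_ball_finite eventually_at_right_less) auto
  then show ?thesis
    using eventually_happens'[OF trivial_limit_at_right_real] by blast
qed

section \<open>The nonterminating Saalschuetz integral\<close>

text \<open>
  Residues at \<open>\<alpha> q\<^sup>n\<close> and \<open>q\<^sup>n / \<alpha>\<close> turn the integral of this kernel into the two balanced \<open>\<^sub>3\<phi>\<^sub>2\<close> series
  of the nonterminating \<open>q\<close>-Saalschuetz formula.
\<close>

definition saalschuetz_kernel :: "complex \<Rightarrow> complex \<Rightarrow> complex \<Rightarrow> complex \<Rightarrow> complex \<Rightarrow> complex \<Rightarrow> complex" where
  "saalschuetz_kernel x \<alpha> t3 t4 t5 w = th (x * w) * th (x / w) * P (t3 * t4 * t5 * w) /
     (P (t3 * w) * P (t4 * w) * P (t5 * w) * P (\<alpha> / w) * P (1 / (\<alpha> * w)))"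

text \<open>
  The rational identity behind the shift \<open>t\<^sub>5 \<mapsto> q t\<^sub>5\<close>, after division by all infinite products, with
  \<open>v = 1 / w\<close> and \<open>\<beta> = 1 / \<alpha>\<close>. On the right the terms in \<open>v\<close> and
  \<open>w\<^sup>2\<close> cancel, and the remaining linear polynomials in
  \<open>w\<close> agree at \<open>w = 1 / t\<^sub>5\<close>, which fixes the factor \<open>t\<^sub>5\<close>, and at \<open>w = 1 / (t\<^sub>3 t\<^sub>4 t\<^sub>5)\<close>.
\<close>

lemma saalschuetz_telescoping_identity:
  fixes t3 t4 t5 w v \<alpha> \<beta> :: complex
  assumes "w * v = 1" "\<alpha> * \<beta> = 1"
  shows "(1 - \<alpha> * t5) * (1 - \<beta> * t5) * (1 - t3 * t4 * t5 * w)
       - (1 - t3 * t5) * (1 - t4 * t5) * (1 - t5 * w)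
       = t5 * w * (1 - \<alpha> * v) * (1 - \<beta> * v) * (1 - t3 * t4 * t5 * w)
       - t5 * v * (1 - t3 * w) * (1 - t4 * w) * (1 - t5 * w)"
  using assms by algebra

text \<open>
  The kernel times \<open>t\<^sub>5 w (1 - \<alpha>/w) (1 - 1/(\<alpha> w))\<close>. The last two factors remove the poles at \<open>\<alpha>\<close> and
  \<open>1/\<alpha>\<close>, so that the remaining inner poles lie strictly inside the circle through \<open>q * w0\<close>.
\<close>

definition saalschuetz_telescoper :: "complex \<Rightarrow> complex \<Rightarrow> complex \<Rightarrow> complex \<Rightarrow> complex \<Rightarrow> complex \<Rightarrow> complex" where
  "saalschuetz_telescoper x \<alpha> t3 t4 t5 w = th (x * w) * th (x / w) * P (t3 * t4 * t5 * w) * (t5 * w) /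
     (P (t3 * w) * P (t4 * w) * P (t5 * w) * P (q * (\<alpha> / w)) * P (q * (1 / (\<alpha> * w))))"

lemma saalschuetz_kernel_shift:
  assumes nz: "x \<noteq> 0" "\<alpha> \<noteq> 0" "w \<noteq> 0"
    and P: "P (t3 * w) \<noteq> 0" "P (t4 * w) \<noteq> 0" "P (t5 * w) \<noteq> 0" "P (\<alpha> / w) \<noteq> 0" "P (1 / (\<alpha> * w)) \<noteq> 0"
  shows "(1 - \<alpha> * t5) * (1 - t5 / \<alpha>) * saalschuetz_kernel x \<alpha> t3 t4 t5 w
       - (1 - t3 * t5) * (1 - t4 * t5) * saalschuetz_kernel x \<alpha> t3 t4 (q * t5) w
       = saalschuetz_telescoper x \<alpha> t3 t4 t5 w - saalschuetz_telescoper x \<alpha> t3 t4 t5 (q * w)"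
proof -
  define Q where "Q t = P (q * t)" for t
  have P_Q: "P t = (1 - t) * Q t" for t
    unfolding Q_def by (rule P_eq_mult_P_q)
  define v where "v = 1 / w"
  define \<beta> where "\<beta> = 1 / \<alpha>"
  \<comment> \<open>\<open>N\<close> is the common factor of the four values below; its factor \<open>1 / M\<close> makes the cofactors polynomial in \<open>w\<close> and \<open>v\<close>.\<close>
  define M where "M = (1 - t3 * w) * (1 - t4 * w) * (1 - t5 * w) * (1 - \<alpha> * v) * (1 - \<beta> * v)"
  define N where "N = th (x * w) * th (x / w) * Q (t3 * t4 * t5 * w) /
     (Q (t3 * w) * Q (t4 * w) * Q (t5 * w) * Q (\<alpha> * v) * Q (\<beta> * v)) / M"
  have vb: "\<alpha> / w = \<alpha> * v" "1 / (\<alpha> * w) = \<beta> * v" "w * v = 1" "\<alpha> * \<beta> = 1"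
    using nz by (simp_all add: v_def \<beta>_def)
  have nzM: "1 - t3 * w \<noteq> 0" "1 - t4 * w \<noteq> 0" "1 - t5 * w \<noteq> 0" "1 - \<alpha> * v \<noteq> 0" "1 - \<beta> * v \<noteq> 0"
    using P unfolding vb P_Q by auto
  have qw: "t * (q * w) = q * (t * w)" "q * (\<alpha> / (q * w)) = \<alpha> * v" "q * (1 / (\<alpha> * (q * w))) = \<beta> * v" for t
    using nz q0 by (simp_all add: v_def \<beta>_def)
  have e1: "saalschuetz_kernel x \<alpha> t3 t4 t5 w = N * (1 - t3 * t4 * t5 * w)"
    unfolding saalschuetz_kernel_def vb P_Q N_def M_def by (simp add: mult_ac)
  have e2: "saalschuetz_kernel x \<alpha> t3 t4 (q * t5) w = N * (1 - t5 * w)"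
  proof -
    have "P (t3 * t4 * (q * t5) * w) = Q (t3 * t4 * t5 * w)" "P (q * t5 * w) = Q (t5 * w)"
      by (simp_all add: Q_def mult_ac)
    then show ?thesis
      unfolding saalschuetz_kernel_def N_def M_def vb P_Q[of "t3 * w"] P_Q[of "t4 * w"] P_Q[of "\<alpha> * v"] P_Q[of "\<beta> * v"]
      using nzM by (simp add: mult_ac)
  qed
  have e3: "saalschuetz_telescoper x \<alpha> t3 t4 t5 w = N * (t5 * w * (1 - \<alpha> * v) * (1 - \<beta> * v) * (1 - t3 * t4 * t5 * w))"
    unfolding saalschuetz_telescoper_def vb Q_def[symmetric] unfolding P_Q N_def M_def using nzM by (simp add: mult_ac)
  have e4: "saalschuetz_telescoper x \<alpha> t3 t4 t5 (q * w) = N * (t5 * v * (1 - t3 * w) * (1 - t4 * w) * (1 - t5 * w))"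
    unfolding saalschuetz_telescoper_def th_product_shift[OF nz(1,3)] unfolding qw(2,3) unfolding qw(1) Q_def[symmetric]
    unfolding P_Q N_def M_def using nzM nz q0
    by (simp add: v_def power2_eq_square mult_ac)
  have "t5 / \<alpha> = \<beta> * t5"
    by (simp add: \<beta>_def)
  then show ?thesis
    unfolding e1 e2 e3 e4 using saalschuetz_telescoping_identity[OF vb(3,4), of t5 t3 t4] by algebra
qed

end

text \<open>
  The circle through \<open>w0\<close> encloses the zeros \<open>\<alpha> q\<^sup>n\<close> and \<open>q\<^sup>n / \<alpha>\<close> of \<open>(\<alpha>/w, 1/(\<alpha> w); q)\<^sub>\<infinity>\<close>, while for every
  parameter \<open>t\<close> with \<open>norm t * norm w0 < 1\<close> the zeros of \<open>(t w; q)\<^sub>\<infinity>\<close> lie outside.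
\<close>

locale separating_circle = q_in_unit_disc +
  fixes x \<alpha> w0 :: complex
  assumes x0: "x \<noteq> 0" and al0: "\<alpha> \<noteq> 0"
    and al1: "norm \<alpha> < norm w0" and al2: "1 / norm \<alpha> < norm w0"
begin

lemma w0_gt_1: "1 < norm w0"
proof -
  have "norm \<alpha> * (1 / norm \<alpha>) < norm w0 * norm w0"
    using al0 al1 al2 by (intro mult_strict_mono) auto
  then show ?thesis using al0
    by (smt (verit) mult_left_le_one_le nonzero_mult_div_cancel_left norm_ge_zero norm_eq_zero times_divide_eq_right mult.right_neutral)
qed

lemma w_nonzero: "norm w = norm w0 \<Longrightarrow> w \<noteq> 0"
  using w0_gt_1 by auto

lemma P_outer_nonzero: "norm t * norm w0 < 1 \<Longrightarrow> norm w = norm w0 \<Longrightarrow> P (t * w) \<noteq> 0"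
  by (rule P_nonzero) (simp add: norm_mult)

lemma P_inner_nonzero:
  assumes "norm w = norm w0"
  shows "P (\<alpha> / w) \<noteq> 0" "P (1 / (\<alpha> * w)) \<noteq> 0"
proof -
  show "P (\<alpha> / w) \<noteq> 0"
    using al1 assms w0_gt_1 by (intro P_nonzero) (simp add: norm_divide divide_less_eq_1)
  have "1 / norm \<alpha> / norm w0 < 1"
    using al2 w0_gt_1 by (subst divide_less_eq_1_pos) auto
  then show "P (1 / (\<alpha> * w)) \<noteq> 0"
    using assms by (intro P_nonzero) (simp add: norm_divide norm_mult)
qed

lemma P_inner_nonzero_shifted:
  assumes "norm q * max (norm \<alpha>) (1 / norm \<alpha>) < norm w"
  shows "P (q * (\<alpha> / w)) \<noteq> 0" "P (q * (1 / (\<alpha> * w))) \<noteq> 0" "w \<noteq> 0"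
proof -
  have "norm q * norm \<alpha> < norm w" "norm q * (1 / norm \<alpha>) < norm w"
    using assms mult_left_mono[of "norm \<alpha>" "max (norm \<alpha>) (1 / norm \<alpha>)" "norm q"]
      mult_left_mono[of "1 / norm \<alpha>" "max (norm \<alpha>) (1 / norm \<alpha>)" "norm q"]
    by auto
  moreover show "w \<noteq> 0"
    using le_less_trans[OF mult_nonneg_nonneg[OF norm_ge_zero norm_ge_zero] calculation(1)] by simp
  ultimately show "P (q * (\<alpha> / w)) \<noteq> 0" "P (q * (1 / (\<alpha> * w))) \<noteq> 0"
    using al0 by (auto intro!: P_nonzero simp: norm_mult norm_divide divide_simps mult_ac)
qed

lemma product_lt_1:
  fixes s t :: complex
  assumes "norm s * norm w0 < 1" "norm t * norm w0 < 1"
  shows "norm (s * t) < 1"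
proof -
  have "norm s < 1" if "norm s * norm w0 < 1" for s :: complex
    using that w0_gt_1 mult_left_mono[of 1 "norm w0" "norm s"] by simp
  with assms show ?thesis
    by (simp add: norm_mult) (metis mult_strict_mono norm_ge_zero mult_1 zero_less_one)
qed

lemma al_product_lt_1:
  fixes t :: complex
  assumes "norm t * norm w0 < 1"
  shows "norm (\<alpha> * t) < 1" "norm (t / \<alpha>) < 1"
proof -
  show "norm (\<alpha> * t) < 1"
    using assms al1 mult_left_mono[of "norm \<alpha>" "norm w0" "norm t"] by (simp add: norm_mult mult.commute)
  show "norm (t / \<alpha>) < 1"
    using assms al2 mult_left_mono[of "1 / norm \<alpha>" "norm w0" "norm t"] by (simp add: norm_divide)
qed

lemma scaled_small:
  assumes "norm t * norm w0 < 1"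
  shows "norm (q * t) * norm w0 < 1"
proof -
  have "norm q * (norm t * norm w0) \<le> norm t * norm w0"
    using q1 by (intro mult_left_le_one_le) auto
  with assms show ?thesis by (simp add: norm_mult mult.assoc)
qed

lemma circle_integral_saalschuetz_shift:
  assumes t: "norm t3 * norm w0 < 1" "norm t4 * norm w0 < 1" "norm t5 * norm w0 < 1"
  shows "(1 - \<alpha> * t5) * (1 - t5 / \<alpha>) * circle_integral (saalschuetz_kernel x \<alpha> t3 t4 t5) w0
       = (1 - t3 * t5) * (1 - t4 * t5) * circle_integral (saalschuetz_kernel x \<alpha> t3 t4 (q * t5)) w0"
proof -
  note qt5 = scaled_small[OF t(3)]
  \<comment> \<open>The largest modulus of an inner pole of the telescoping function.\<close>
  define r1 where "r1 = norm q * max (norm \<alpha>) (1 / norm \<alpha>)"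
  obtain r2 where r2: "norm w0 < r2" "\<And>t. t \<in> {t3, t4, t5} \<Longrightarrow> norm t * r2 < 1"
    using ex_larger_radius[of "{t3, t4, t5}" "norm w0"] t by auto
  have cont: "continuous_on (sphere 0 (norm w0)) (saalschuetz_kernel x \<alpha> t3 t4 t)"
    if "norm t * norm w0 < 1" for t
    unfolding saalschuetz_kernel_def using that t
    by (intro continuous_intros ballI) (auto simp: P_outer_nonzero P_inner_nonzero w_nonzero x0 al0)
  show ?thesis
  proof (rule circle_integral_q_telescope)
    show "0 < r1" using al0 q0 by (simp add: r1_def max_def)
    show "r1 < norm (q * w0)" using al1 al2 q0 by (simp add: r1_def norm_mult)
    show "norm w0 < r2" by fact
    show "saalschuetz_telescoper x \<alpha> t3 t4 t5 holomorphic_on {w. r1 < norm w \<and> norm w < r2}"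
    proof -
      have 1: "P (t * w) \<noteq> 0" if "t \<in> {t3, t4, t5}" "norm w < r2" for t w
      proof (rule P_nonzero)
        have "norm t * norm w \<le> norm t * r2" using that by (intro mult_left_mono) auto
        then show "norm (t * w) < 1" using r2(2)[OF that(1)] by (simp add: norm_mult)
      qed
      have 2: "P (q * (\<alpha> / w)) \<noteq> 0 \<and> P (q * (1 / (\<alpha> * w))) \<noteq> 0 \<and> w \<noteq> 0" if "r1 < norm w" for w
        using P_inner_nonzero_shifted that unfolding r1_def by blast
      show ?thesis
        unfolding saalschuetz_telescoper_def by (intro holomorphic_intros) (use 1 2 al0 x0 in auto)
    qed
    show "(1 - \<alpha> * t5) * (1 - t5 / \<alpha>) * saalschuetz_kernel x \<alpha> t3 t4 t5 w
       - (1 - t3 * t5) * (1 - t4 * t5) * saalschuetz_kernel x \<alpha> t3 t4 (q * t5) w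
       = saalschuetz_telescoper x \<alpha> t3 t4 t5 w - saalschuetz_telescoper x \<alpha> t3 t4 t5 (q * w)" if "norm w = norm w0" for w
      using that t by (intro saalschuetz_kernel_shift x0 al0 w_nonzero P_outer_nonzero P_inner_nonzero)
  qed (use t qt5 in \<open>auto intro: cont\<close>)
qed

text \<open>
  The quotient \<open>J\<close> of the integral and its expected dependence on \<open>t\<^sub>5\<close> is invariant under
  \<open>t\<^sub>5 \<mapsto> q t\<^sub>5\<close> and continuous on the disc of admissible \<open>t\<^sub>5\<close>, hence equal to its value at \<open>t\<^sub>5 = 0\<close>.
\<close>

lemma circle_integral_saalschuetz_remove_parameter:
  assumes t: "norm t3 * norm w0 < 1" "norm t4 * norm w0 < 1" "norm t5 * norm w0 < 1"
  shows "circle_integral (saalschuetz_kernel x \<alpha> t3 t4 t5) w0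
       = P (t3 * t5) * P (t4 * t5) / (P (\<alpha> * t5) * P (t5 / \<alpha>)) * circle_integral (saalschuetz_kernel x \<alpha> t3 t4 0) w0"
proof -
  define J where "J t = circle_integral (saalschuetz_kernel x \<alpha> t3 t4 t) w0 * P (\<alpha> * t) * P (t / \<alpha>) / (P (t3 * t) * P (t4 * t))" for t
  define U where "U = {t :: complex. norm t * norm w0 < 1}"
  have nz: "P (t3 * t) \<noteq> 0" "P (t4 * t) \<noteq> 0" "P (\<alpha> * t) \<noteq> 0" "P (t / \<alpha>) \<noteq> 0"
    if "norm t * norm w0 < 1" for t
    using product_lt_1[OF t(1) that] product_lt_1[OF t(2) that] al_product_lt_1[OF that]
    by (simp_all add: P_nonzero)
  have "J t5 = J 0"
  proof (rule eq_at_zero_if_invariant_under_contraction[OF q1, of U])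
    show "open U" unfolding U_def by (intro open_Collect_less continuous_intros)
    show "q * t \<in> U" if "t \<in> U" for t
      using that scaled_small by (simp add: U_def)
    show "continuous_on U J"
    proof -
      have "continuous_on U (\<lambda>t. circle_integral (saalschuetz_kernel x \<alpha> t3 t4 t) w0)"
        by (rule continuous_on_circle_integral, unfold split_def saalschuetz_kernel_def, intro continuous_intros ballI)
           (use t w0_gt_1 in \<open>auto simp: U_def P_outer_nonzero P_inner_nonzero x0 al0 norm_mult\<close>)
      then show ?thesis unfolding J_def using nz al0 U_def by (intro continuous_intros ballI) auto
    qed
    show "J (q * t) = J t" if "t \<in> U" for t
    proof -
      have tb: "norm t * norm w0 < 1" using that by (simp add: U_def)
      define C where "C = circle_integral (saalschuetz_kernel x \<alpha> t3 t4 (q * t)) w0"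
      define D where "D = circle_integral (saalschuetz_kernel x \<alpha> t3 t4 t) w0"
      have *: "(1 - \<alpha> * t) * (1 - t / \<alpha>) * D = (1 - t3 * t) * (1 - t4 * t) * C"
        unfolding C_def D_def by (rule circle_integral_saalschuetz_shift[OF t(1,2) tb])
      have r: "P (\<alpha> * t) = (1 - \<alpha> * t) * P (\<alpha> * (q * t))" "P (t / \<alpha>) = (1 - t / \<alpha>) * P (q * t / \<alpha>)"
        "P (t3 * t) = (1 - t3 * t) * P (t3 * (q * t))" "P (t4 * t) = (1 - t4 * t) * P (t4 * (q * t))"
        using P_eq_mult_P_q[of "\<alpha> * t"] P_eq_mult_P_q[of "t / \<alpha>"] P_eq_mult_P_q[of "t3 * t"] P_eq_mult_P_q[of "t4 * t"]
        by (simp_all add: mult_ac)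
      have "(1 - t3 * t) \<noteq> 0" "(1 - t4 * t) \<noteq> 0" using nz[OF tb] r by auto
      then have "C = (1 - \<alpha> * t) * (1 - t / \<alpha>) * D / ((1 - t3 * t) * (1 - t4 * t))"
        by (intro eq_divide_imp) (use * in \<open>simp_all add: mult_ac\<close>)
      then show ?thesis unfolding J_def C_def[symmetric] D_def[symmetric] r
        by (simp add: mult_ac)
    qed
  qed (use t in \<open>auto simp: U_def\<close>)
  then show ?thesis using nz[OF t(3)] by (simp add: J_def field_simps)
qed

text \<open>
  The kernel is symmetric in its three parameters, so they can be removed one after the other.
\<close>

lemma circle_integral_saalschuetz:
  assumes t: "norm t3 * norm w0 < 1" "norm t4 * norm w0 < 1" "norm t5 * norm w0 < 1"
  shows "circle_integral (saalschuetz_kernel x \<alpha> t3 t4 t5) w0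
       = P (t3 * t4) * P (t3 * t5) * P (t4 * t5) /
         (P (\<alpha> * t3) * P (t3 / \<alpha>) * P (\<alpha> * t4) * P (t4 / \<alpha>) * P (\<alpha> * t5) * P (t5 / \<alpha>))
         * circle_integral (saalschuetz_kernel x \<alpha> 0 0 0) w0"
proof -
  have 0: "norm (0 :: complex) * norm w0 < 1" by simp
  have "saalschuetz_kernel x \<alpha> t3 t4 0 = saalschuetz_kernel x \<alpha> t3 0 t4" "saalschuetz_kernel x \<alpha> t3 0 0 = saalschuetz_kernel x \<alpha> 0 0 t3"
    by (auto simp: saalschuetz_kernel_def fun_eq_iff)
  then show ?thesis
    using circle_integral_saalschuetz_remove_parameter[OF t] circle_integral_saalschuetz_remove_parameter[OF t(1) 0 t(2)] circle_integral_saalschuetz_remove_parameter[OF 0 0 t(1)]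
    by (simp add: mult_ac)
qed

end

section \<open>Evaluation of the parameter-free integral\<close>

context separating_circle
begin

text \<open>
  With parameters \<open>x\<close> and \<open>q / x\<close> the factors \<open>(x w, q w / x; q)\<^sub>\<infinity>\<close> of the theta product cancel. The rest
  is a function of \<open>1 / w\<close> that is holomorphic outside the circle and equals \<open>1\<close> at infinity, so its
  integral is \<open>2 \<pi>\<close>. Removing the two parameters again gives the parameter-free integral.
\<close>

lemma circle_integral_theta_cancelling:
  assumes x: "norm x * norm w0 < 1" "norm (q / x) * norm w0 < 1"
  shows "circle_integral (saalschuetz_kernel x \<alpha> 0 0 0) w0 = 2 * of_real pi * (th (x * \<alpha>) * th (x / \<alpha>) / P q)"
proof -
  \<comment> \<open>The kernel with both cancellations carried out, in the variable \<open>v = 1 / w\<close>.\<close>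
  define f where "f v = P (q / x * v) * P (x * v) / (P (\<alpha> * v) * P (1 / \<alpha> * v))" for v
  define r where "r = 1 / max (norm \<alpha>) (1 / norm \<alpha>)"
  have m: "norm \<alpha> \<le> 1 / r" "1 / norm \<alpha> \<le> 1 / r" "0 < r"
    using al0 by (auto simp: r_def less_max_iff_disj)
  have f: "f holomorphic_on ball 0 r"
  proof -
    have "P (\<alpha> * v) \<noteq> 0" "P (1 / \<alpha> * v) \<noteq> 0" if "v \<in> ball 0 r" for v
    proof -
      have "norm s * norm v < 1" if "norm s \<le> 1 / r" for s :: complex
      proof -
        have "norm s * norm v \<le> 1 / r * norm v" using that by (intro mult_right_mono) auto
        also have "\<dots> < 1" using \<open>v \<in> ball 0 r\<close> m(3) by simp
        finally show ?thesis .
      qed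
      from this[of \<alpha>] this[of "1 / \<alpha>"] show "P (\<alpha> * v) \<noteq> 0" "P (1 / \<alpha> * v) \<noteq> 0"
        using m by (auto intro!: P_nonzero simp: norm_mult norm_divide)
    qed
    then show ?thesis
      unfolding f_def by (intro holomorphic_intros) auto
  qed
  have "1 / norm w0 < r"
    using al1 al2 al0 w0_gt_1 unfolding r_def
    by (intro divide_strict_left_mono mult_pos_pos) (auto simp: less_max_iff_disj)
  then have f_val: "circle_integral f (1 / w0) = 2 * of_real pi"
    using circle_integral_eq_value_at_zero[OF f, of "1 / w0"] by (simp add: norm_divide f_def)
  have "circle_integral (saalschuetz_kernel x \<alpha> x (q / x) 0) w0 = circle_integral (\<lambda>w. f (1 / w)) w0"
    unfolding circle_integral_def
  proof (rule integral_cong)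
    fix \<psi>
    define w where "w = w0 * cis \<psi>"
    have w: "norm w = norm w0" by (simp add: w_def norm_mult)
    have "P (x * w) \<noteq> 0" "P (q / x * w) \<noteq> 0"
      by (rule P_outer_nonzero[OF x(1) w], rule P_outer_nonzero[OF x(2) w])
    moreover have "q / (x / w) = q / x * w" by simp
    ultimately have "saalschuetz_kernel x \<alpha> x (q / x) 0 w = f (1 / w)"
      by (simp add: saalschuetz_kernel_def th_eq f_def)
    then show "saalschuetz_kernel x \<alpha> x (q / x) 0 (w0 * cis \<psi>) = f (1 / (w0 * cis \<psi>))"
      by (simp add: w_def)
  qed
  then have 1: "circle_integral (saalschuetz_kernel x \<alpha> x (q / x) 0) w0 = 2 * of_real pi"
    unfolding circle_integral_reciprocal f_val .
  have nz: "P (\<alpha> * x) \<noteq> 0" "P (x / \<alpha>) \<noteq> 0" "P (\<alpha> * (q / x)) \<noteq> 0" "P (q / x / \<alpha>) \<noteq> 0"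
    using al_product_lt_1[OF x(1)] al_product_lt_1[OF x(2)] by (simp_all only: P_nonzero not_False_eq_True)
  have "circle_integral (saalschuetz_kernel x \<alpha> x (q / x) 0) w0
      = P q / (P (\<alpha> * x) * P (x / \<alpha>) * P (\<alpha> * (q / x)) * P (q / x / \<alpha>)) * circle_integral (saalschuetz_kernel x \<alpha> 0 0 0) w0"
    using circle_integral_saalschuetz[OF x(1) x(2), of 0] x0 by simp
  moreover have "th (x * \<alpha>) * th (x / \<alpha>) = P (\<alpha> * x) * P (x / \<alpha>) * P (\<alpha> * (q / x)) * P (q / x / \<alpha>)"
  proof -
    have "q / (x * \<alpha>) = q / x / \<alpha>" "q / (x / \<alpha>) = \<alpha> * (q / x)" using x0 by (simp_all add: mult.commute)
    then show ?thesis unfolding th_eq by (simp only: mult_ac)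
  qed
  ultimately show ?thesis
    using 1 nz P_nonzero[OF q1] by (simp add: field_simps)
qed

end

context q_in_unit_disc
begin

lemma saalschuetz_kernel_zero: "saalschuetz_kernel x \<alpha> 0 0 0 w = th (x * w) * th (x / w) / (P (\<alpha> / w) * P (1 / (\<alpha> * w)))"
  by (simp add: saalschuetz_kernel_def)

text \<open>
  If \<open>norm q * norm w0 ^ 2 < 1\<close>, the annulus of those \<open>x\<close> for which \<open>x\<close> and \<open>q / x\<close> are both admissible
  parameters is not empty. Both sides are holomorphic in \<open>x \<noteq> 0\<close>.
\<close>

lemma circle_integral_theta_near_unit_circle:
  assumes "separating_circle q x \<alpha> w0" and thin: "norm q * norm w0 ^ 2 < 1"
  shows "circle_integral (saalschuetz_kernel x \<alpha> 0 0 0) w0 = 2 * of_real pi * (th (x * \<alpha>) * th (x / \<alpha>) / P q)"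
proof -
  interpret separating_circle q x \<alpha> w0 by fact
  have qc: "separating_circle q y \<alpha> w0" if "y \<noteq> 0" for y
    by unfold_locales (use that al0 al1 al2 in auto)
  define S where "S = {y :: complex. norm q * norm w0 < norm y \<and> norm y * norm w0 < 1}"
  have small: "norm q * norm w0 < sqrt (norm q)" "sqrt (norm q) * norm w0 < 1"
  proof -
    have "sqrt (norm q) * norm w0 = sqrt (norm q * norm w0 ^ 2)"
      by (simp add: real_sqrt_mult)
    also have "\<dots> < 1" using thin by simp
    finally show s: "sqrt (norm q) * norm w0 < 1" .
    have "norm q * norm w0 = sqrt (norm q) * (sqrt (norm q) * norm w0)" by simp
    also have "\<dots> < sqrt (norm q) * 1"
      using s q0 by (intro mult_strict_left_mono) auto
    finally show "norm q * norm w0 < sqrt (norm q)" by simp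
  qed
  have thd: "(th has_field_derivative deriv th y) (at y)" if "y \<noteq> 0" for y
    by (rule holomorphic_derivI[of _ "-{0}"]) (use that in \<open>auto intro!: holomorphic_intros\<close>)
  have "deriv th holomorphic_on -{0}"
    by (rule holomorphic_deriv) (auto intro!: holomorphic_intros)
  then have cthd: "continuous_on (-{0}) (deriv th)"
    by (rule holomorphic_on_imp_continuous_on)
  note [continuous_intros] = continuous_on_compose2[OF cthd]
  show ?thesis
  proof (rule analytic_continuation_open[of S "-{0}" "\<lambda>y. circle_integral (saalschuetz_kernel y \<alpha> 0 0 0) w0"
        "\<lambda>y. 2 * of_real pi * (th (y * \<alpha>) * th (y / \<alpha>) / P q)"])
    show "open S" unfolding S_def by (intro open_Collect_conj open_Collect_less continuous_intros)
    \<comment> \<open>The geometric mean of the two bounding radii of \<open>S\<close>.\<close>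
    have "complex_of_real (sqrt (norm q)) \<in> S"
      using small by (simp add: S_def)
    then show "S \<noteq> {}" by blast
    show "connected (- {0 :: complex})"
      using connected_punctured_universe[of "0 :: complex"] by (simp add: Compl_eq_Diff_UNIV)
    show "S \<subseteq> - {0}" unfolding S_def by auto (use mult_nonneg_nonneg in \<open>smt (verit) norm_ge_zero\<close>)
    show "(\<lambda>y. 2 * of_real pi * (th (y * \<alpha>) * th (y / \<alpha>) / P q)) holomorphic_on - {0}"
      by (intro holomorphic_intros) (use al0 P_nonzero[OF q1] in auto)
    show "circle_integral (saalschuetz_kernel y \<alpha> 0 0 0) w0 = 2 * of_real pi * (th (y * \<alpha>) * th (y / \<alpha>) / P q)"
      if y: "y \<in> S" for y
    proof -
      have y0: "y \<noteq> 0" using \<open>S \<subseteq> - {0}\<close> y by auto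
      then have "norm (q / y) * norm w0 < 1"
        using y by (simp add: S_def norm_divide field_simps)
      then show ?thesis
        using separating_circle.circle_integral_theta_cancelling[OF qc[OF y0]] y by (simp add: S_def)
    qed
    show "(\<lambda>y. circle_integral (saalschuetz_kernel y \<alpha> 0 0 0) w0) holomorphic_on - {0}"
    proof -
      define W where "W t = w0 * cis t" for t
      define c where "c t = 1 / (P (\<alpha> / W t) * P (1 / (\<alpha> * W t)))" for t
      have W: "W t \<noteq> 0" "norm (W t) = norm w0" for t
        using w0_gt_1 by (auto simp: W_def norm_mult)
      have W_cont [continuous_intros]: "continuous_on A (\<lambda>x. W (g x))" if "continuous_on A g" for A :: "(complex \<times> real) set" and g
        unfolding W_def by (intro continuous_intros that)
      have c_cont [continuous_intros]: "continuous_on A (\<lambda>x. c (g x))" if "continuous_on A g" for A :: "(complex \<times> real) set" and g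
        unfolding c_def by (intro continuous_intros that) (use W al0 P_inner_nonzero in auto)
      have "(\<lambda>y. integral {-pi..pi} (\<lambda>t. th (y * W t) * th (y / W t) * c t)) holomorphic_on - {0}"
      proof (rule holomorphic_on_integral_param[where f' =
            "\<lambda>y t. (deriv th (y * W t) * W t * th (y / W t) + th (y * W t) * (deriv th (y / W t) / W t)) * c t"])
        show "((\<lambda>y. th (y * W t) * th (y / W t) * c t) has_field_derivative
           (deriv th (y * W t) * W t * th (y / W t) + th (y * W t) * (deriv th (y / W t) / W t)) * c t) (at y)"
          if "y \<in> -{0}" for y t
        proof -
          have "((\<lambda>y. th (y * W t)) has_field_derivative deriv th (y * W t) * W t) (at y)"
            by (rule DERIV_chain2[OF thd]) (use that W in \<open>auto intro!: derivative_eq_intros\<close>)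
          moreover have "((\<lambda>y. th (y / W t)) has_field_derivative deriv th (y / W t) * (1 / W t)) (at y)"
            by (rule DERIV_chain2[OF thd]) (use that W in \<open>auto intro!: derivative_eq_intros\<close>)
          ultimately show ?thesis
            by (auto intro!: derivative_eq_intros)
        qed
      qed (unfold split_def, auto intro!: continuous_intros simp: W)
      then show ?thesis
        by (simp add: circle_integral_def saalschuetz_kernel_zero W_def c_def)
    qed
  qed (use x0 in auto)
qed

text \<open>
  Both sides are holomorphic in \<open>\<alpha>\<close> on the annulus \<open>1 / norm w0 < norm \<alpha> < norm w0\<close>. For \<open>\<alpha>\<close> close to
  the unit circle the contour may be contracted until the previous lemma applies.
\<close>

lemma circle_integral_theta:
  assumes "separating_circle q x \<alpha> w0"
  shows "circle_integral (saalschuetz_kernel x \<alpha> 0 0 0) w0 = 2 * of_real pi * (th (x * \<alpha>) * th (x / \<alpha>) / P q)"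
proof -
  interpret separating_circle q x \<alpha> w0 by fact
  define R where "R = norm w0"
  have "\<forall>\<^sub>F r in at_right 1. norm q * r\<^sup>2 < 1"
    using q1 by (intro order_tendstoD(2)[of _ "norm q * 1\<^sup>2"] tendsto_intros) simp_all
  moreover have "\<forall>\<^sub>F r in at_right 1. r < R"
    using w0_gt_1 unfolding R_def by (intro order_tendstoD(2)[of _ 1] tendsto_intros)
  ultimately have "\<forall>\<^sub>F r in at_right 1. norm q * r\<^sup>2 < 1 \<and> r < R \<and> 1 < (r :: real)"
    by (intro eventually_conj eventually_at_right_less)
  then obtain r where r: "norm q * r\<^sup>2 < 1" "r < R" "1 < r"
    using eventually_happens'[OF trivial_limit_at_right_real] by blast
  define A where "A s = {b :: complex. 1 / s < norm b \<and> norm b < s}" for s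
  have A: "b \<noteq> 0" "1 / norm b < s" if "b \<in> A s" "s > 1" for b s
  proof -
    show "b \<noteq> 0" using that by (auto simp: A_def)
    then show "1 / norm b < s" using that by (auto simp: A_def field_simps)
  qed
  have openA: "open (A s)" for s
    unfolding A_def by (intro open_Collect_conj open_Collect_less continuous_intros)
  define S where "S v = inverse (P v)" for v
  have holS: "S holomorphic_on ball 0 1"
    unfolding S_def by (intro holomorphic_intros) (auto dest: P_nonzero)
  have Sd: "(S has_field_derivative deriv S v) (at v)" if "norm v < 1" for v
    by (rule holomorphic_derivI[OF holS]) (use that in auto)
  have cS: "continuous_on (ball 0 1) S" and cSd: "continuous_on (ball 0 1) (deriv S)"
    by (rule holomorphic_on_imp_continuous_on[OF holS],
        rule holomorphic_on_imp_continuous_on[OF holomorphic_deriv[OF holS open_ball]])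
  show ?thesis
  proof (rule analytic_continuation_open[of "A r" "A R" "\<lambda>b. circle_integral (saalschuetz_kernel x b 0 0 0) w0"
        "\<lambda>b. 2 * of_real pi * (th (x * b) * th (x / b) / P q)"])
    show "open (A r)" "open (A R)" by (rule openA)+
    show "A r \<noteq> {}" using r by (auto simp: A_def intro!: exI[of _ 1])
    show "connected (A R)"
      using connected_annulus(1)[of "1 / R" "0 :: complex" R] by (simp add: A_def)
    have "1 / R < 1 / r" using r by (simp add: field_simps)
    then show "A r \<subseteq> A R" using r by (auto simp: A_def)
    show "(\<lambda>b. 2 * of_real pi * (th (x * b) * th (x / b) / P q)) holomorphic_on A R"
      by (intro holomorphic_intros) (use x0 A(1)[of _ R] w0_gt_1 P_nonzero[OF q1] in \<open>auto simp: R_def\<close>)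
    show "\<alpha> \<in> A R"
    proof -
      have "1 / norm w0 < norm \<alpha>"
        using al0 al2 w0_gt_1 by (subst divide_less_eq) (auto simp: divide_less_eq mult.commute)
      then show ?thesis using al1 by (simp add: A_def R_def)
    qed
    show "circle_integral (saalschuetz_kernel x b 0 0 0) w0 = 2 * of_real pi * (th (x * b) * th (x / b) / P q)"
      if b: "b \<in> A r" for b
    proof -
      note b' = A[OF b r(3)]
      \<comment> \<open>The kernel is holomorphic outside radius \<open>m\<close>, so the contour can be moved from \<open>R\<close> to \<open>r\<close>.\<close>
      define m where "m = max (norm b) (1 / norm b)"
      have m: "norm b \<le> m" "1 / norm b \<le> m" "m < r" "0 < m"
        using b b' by (auto simp: m_def A_def less_max_iff_disj)
      have "circle_integral (saalschuetz_kernel x b 0 0 0) w0 = circle_integral (saalschuetz_kernel x b 0 0 0) (of_real r)"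
      proof (rule circle_integral_eq_on_annulus[where ?r1.0 = m and ?r2.0 = "R + 1"])
        show "saalschuetz_kernel x b 0 0 0 holomorphic_on {w. m < norm w \<and> norm w < R + 1}"
        proof -
          have "P (b / w) \<noteq> 0" "P (1 / (b * w)) \<noteq> 0" "w \<noteq> 0" if "m < norm w" for w
          proof -
            have "norm w > 0" using that m by linarith
            then show "w \<noteq> 0" by simp
            show "P (b / w) \<noteq> 0"
              using that m \<open>norm w > 0\<close> by (intro P_nonzero) (simp add: norm_divide divide_less_eq_1)
            have "1 / norm b / norm w < 1"
              using that m \<open>norm w > 0\<close> by (subst divide_less_eq_1_pos) auto
            then show "P (1 / (b * w)) \<noteq> 0"
              by (intro P_nonzero) (simp add: norm_divide norm_mult)
          qed
          then show ?thesis
            unfolding saalschuetz_kernel_zero by (intro holomorphic_intros) (use b' x0 in auto)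
        qed
      qed (use m r in \<open>auto simp: R_def\<close>)
      also have "\<dots> = 2 * of_real pi * (th (x * b) * th (x / b) / P q)"
      proof (rule circle_integral_theta_near_unit_circle)
        show "separating_circle q x b (of_real r)"
          by unfold_locales (use b b' r x0 in \<open>auto simp: A_def\<close>)
      qed (use r in auto)
      finally show ?thesis .
    qed
    show "(\<lambda>b. circle_integral (saalschuetz_kernel x b 0 0 0) w0) holomorphic_on A R"
    proof -
      define W where "W t = w0 * cis t" for t
      define c where "c t = th (x * W t) * th (x / W t)" for t
      have W: "W t \<noteq> 0" "norm (W t) = R" for t
        using w0_gt_1 by (auto simp: W_def norm_mult R_def)
      have W_cont [continuous_intros]: "continuous_on A (\<lambda>x. W (g x))" if "continuous_on A g" for A :: "(complex \<times> real) set" and g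
        unfolding W_def by (intro continuous_intros that)
      have c_cont [continuous_intros]: "continuous_on A (\<lambda>x. c (g x))" if "continuous_on A g" for A :: "(complex \<times> real) set" and g
        unfolding c_def by (intro continuous_intros that) (use W x0 in auto)
      have lt: "norm (b / W t) < 1" "norm (1 / (b * W t)) < 1" "b \<noteq> 0" if "b \<in> A R" for b t
      proof -
        have R: "R > 1" using w0_gt_1 R_def by simp
        show "b \<noteq> 0" by (rule A(1)[OF that R])
        show "norm (b / W t) < 1"
          using that R by (simp add: norm_divide W A_def divide_less_eq_1)
        have "1 / norm b / R < 1"
          using A(2)[OF that R] R by (subst divide_less_eq_1_pos) auto
        then show "norm (1 / (b * W t)) < 1"
          by (simp add: norm_divide norm_mult W)
      qed
      note [continuous_intros] = continuous_on_compose2[OF cS] continuous_on_compose2[OF cSd]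
      have "(\<lambda>b. integral {-pi..pi} (\<lambda>t. c t * (S (b / W t) * S (1 / (b * W t))))) holomorphic_on A R"
      proof (rule holomorphic_on_integral_param[OF openA, where f' =
            "\<lambda>b t. c t * (deriv S (b / W t) * (1 / W t) * S (1 / (b * W t))
                    + S (b / W t) * (deriv S (1 / (b * W t)) * (- 1 / (b\<^sup>2 * W t))))"])
        show "((\<lambda>b. c t * (S (b / W t) * S (1 / (b * W t)))) has_field_derivative
           c t * (deriv S (b / W t) * (1 / W t) * S (1 / (b * W t))
                    + S (b / W t) * (deriv S (1 / (b * W t)) * (- 1 / (b\<^sup>2 * W t))))) (at b)"
          if "b \<in> A R" for b t
        proof -
          have "((\<lambda>b. S (b / W t)) has_field_derivative deriv S (b / W t) * (1 / W t)) (at b)"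
            by (rule DERIV_chain2[OF Sd]) (use lt[OF that] W in \<open>auto intro!: derivative_eq_intros\<close>)
          moreover have "((\<lambda>b. S (1 / (b * W t))) has_field_derivative deriv S (1 / (b * W t)) * (- 1 / (b\<^sup>2 * W t))) (at b)"
            by (rule DERIV_chain2[OF Sd])
               (use lt[OF that] W in \<open>auto intro!: derivative_eq_intros simp: field_simps power2_eq_square\<close>)
          ultimately show ?thesis
            by (auto intro!: derivative_eq_intros)
        qed
      qed (unfold split_def, use lt W in \<open>auto intro!: continuous_intros\<close>)
      then show ?thesis
        by (simp add: circle_integral_def saalschuetz_kernel_zero W_def c_def S_def field_simps)
    qed
  qed
qed

end

section \<open>The nonterminating Jackson integral\<close>

context q_in_unit_disc
begin

text \<open>
  The very-well-poised kernel. Since \<open>b\<close> and \<open>u\<close> are related by \<open>q b = u t\<^sub>3 t\<^sub>4 t\<^sub>5\<close>, the parameter \<open>b\<close> is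
  expressed by \<open>u\<close>, and the numerator entries \<open>q b / t\<^sub>i\<close> become products of the other two \<open>t\<close> with \<open>u\<close>.
  In this form \<open>u = 0\<close> is a regular point, where the kernel reduces to \<open>saalschuetz_kernel\<close>.
\<close>

definition jackson_kernel :: "complex \<Rightarrow> complex \<Rightarrow> complex \<Rightarrow> complex \<Rightarrow> complex \<Rightarrow> complex \<Rightarrow> complex \<Rightarrow> complex" where
  "jackson_kernel x \<alpha> t3 t4 t5 u w = (let b = u * (t3 * t4 * t5 / q) in
     th (x * w) * th (x / w) * (1 - b * w\<^sup>2) * P (u * t4 * t5 * w) * P (u * t3 * t5 * w) * P (u * t3 * t4 * w)
       * P (t3 * t4 * t5 * w) /
     (P (t3 * w) * P (t4 * w) * P (t5 * w) * P (u * w) * P (\<alpha> / w) * P (1 / (\<alpha> * w))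
       * P (b * \<alpha> * w) * P (b / \<alpha> * w)))"

text \<open>
  As before, the poles of the kernel at \<open>\<alpha>\<close> and \<open>1/\<alpha>\<close> are removed. The factor
  \<open>(t\<^sub>3 t\<^sub>4 t\<^sub>5 w / q; q)\<^sub>\<infinity>\<close> turns into the factor \<open>(t\<^sub>3 t\<^sub>4 t\<^sub>5 w; q)\<^sub>\<infinity>\<close> of the kernel under
  \<open>w \<mapsto> q w\<close>, and \<open>u w (1 - b u w)\<close> takes the place of \<open>1 - b w\<^sup>2\<close>.
\<close>

definition jackson_telescoper :: "complex \<Rightarrow> complex \<Rightarrow> complex \<Rightarrow> complex \<Rightarrow> complex \<Rightarrow> complex \<Rightarrow> complex \<Rightarrow> complex" where
  "jackson_telescoper x \<alpha> t3 t4 t5 u w = (let b = u * (t3 * t4 * t5 / q) in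
     th (x * w) * th (x / w) * P (u * t4 * t5 * w) * P (u * t3 * t5 * w) * P (u * t3 * t4 * w)
       * P (t3 * t4 * t5 / q * w) * (u * w * (1 - b * u * w)) /
     (P (t3 * w) * P (t4 * w) * P (t5 * w) * P (u * w) * P (q * (\<alpha> / w)) * P (q * (1 / (\<alpha> * w)))
       * P (b * \<alpha> * w) * P (b / \<alpha> * w)))"

text \<open>
  The rational identity behind the shift \<open>(b, u) \<mapsto> (q b, q u)\<close>, with \<open>v = 1 / w\<close>, \<open>\<beta> = 1 / \<alpha>\<close> and
  \<open>c = t\<^sub>3 t\<^sub>4 t\<^sub>5 / q\<close>. Eliminating \<open>q\<close> by \<open>q b = u t\<^sub>3 t\<^sub>4 t\<^sub>5\<close> makes it polynomial. On the right the terms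
  of degree \<open>-1\<close> and \<open>6\<close> in \<open>w\<close> cancel, and both sides then agree at the six points \<open>1/u\<close>,
  \<open>1/(b \<alpha>)\<close>, \<open>\<alpha>/b\<close>, \<open>1/(u t\<^sub>j t\<^sub>k)\<close>. The first three of these points determine the factor \<open>u w (1 - b u w)\<close>.
\<close>

lemma jackson_telescoping_identity:
  fixes t3 t4 t5 w v \<alpha> \<beta> u b c :: complex
  assumes "w * v = 1" "\<alpha> * \<beta> = 1" "u * c = b"
  shows "(1 - b) * (1 - \<alpha> * u) * (1 - \<beta> * u)
         * ((1 - b * w\<^sup>2) * (1 - u * t4 * t5 * w) * (1 - u * t3 * t5 * w) * (1 - u * t3 * t4 * w))
       - (1 - u * t3) * (1 - u * t4) * (1 - u * t5)
         * ((1 - u * (t3 * t4 * t5) * w\<^sup>2) * (1 - u * w) * (1 - b * \<alpha> * w) * (1 - b * \<beta> * w))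
       = (1 - u * t4 * t5 * w) * (1 - u * t3 * t5 * w) * (1 - u * t3 * t4 * w) * (1 - c * w)
         * (u * w * (1 - b * u * w)) * (1 - \<alpha> * v) * (1 - \<beta> * v)
       - (1 - t3 * w) * (1 - t4 * w) * (1 - t5 * w) * (1 - u * w) * (1 - b * \<alpha> * w) * (1 - b * \<beta> * w)
         * (u * v * (1 - u\<^sup>2 * (t3 * t4 * t5) * w))"
  using assms by algebra

lemma jackson_kernel_shift:
  fixes t3 t4 t5 u :: complex
  defines "b \<equiv> u * (t3 * t4 * t5 / q)"
  assumes nz: "x \<noteq> 0" "\<alpha> \<noteq> 0" "w \<noteq> 0"
    and P: "P (t3 * w) \<noteq> 0" "P (t4 * w) \<noteq> 0" "P (t5 * w) \<noteq> 0" "P (u * w) \<noteq> 0"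
      "P (\<alpha> / w) \<noteq> 0" "P (1 / (\<alpha> * w)) \<noteq> 0" "P (b * \<alpha> * w) \<noteq> 0" "P (b / \<alpha> * w) \<noteq> 0"
  shows "(1 - b) * (1 - \<alpha> * u) * (1 - u / \<alpha>) * jackson_kernel x \<alpha> t3 t4 t5 u w
       - (1 - u * t3) * (1 - u * t4) * (1 - u * t5) * jackson_kernel x \<alpha> t3 t4 t5 (q * u) w
       = jackson_telescoper x \<alpha> t3 t4 t5 u w - jackson_telescoper x \<alpha> t3 t4 t5 u (q * w)"
proof -
  define Q where "Q t = P (q * t)" for t
  have P_Q: "P t = (1 - t) * Q t" for t
    unfolding Q_def by (rule P_eq_mult_P_q)
  define v where "v = 1 / w"
  define \<beta> where "\<beta> = 1 / \<alpha>"
  define c where "c = t3 * t4 * t5 / q"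
  \<comment> \<open>\<open>N\<close> is the common factor of the four values below; its factor \<open>1 / M\<close> makes the cofactors polynomial in \<open>w\<close> and \<open>v\<close>.\<close>
  define M where "M = (1 - t3 * w) * (1 - t4 * w) * (1 - t5 * w) * (1 - u * w) * (1 - \<alpha> * v) * (1 - \<beta> * v)
                    * (1 - b * \<alpha> * w) * (1 - b * \<beta> * w)"
  define N where "N = th (x * w) * th (x / w) * Q (u * t4 * t5 * w) * Q (u * t3 * t5 * w) * Q (u * t3 * t4 * w)
       * P (t3 * t4 * t5 * w) /
     (Q (t3 * w) * Q (t4 * w) * Q (t5 * w) * Q (u * w) * Q (\<alpha> * v) * Q (\<beta> * v)
       * Q (b * \<alpha> * w) * Q (b * \<beta> * w)) / M"
  have vb: "\<alpha> / w = \<alpha> * v" "1 / (\<alpha> * w) = \<beta> * v" "b / \<alpha> * w = b * \<beta> * w"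
    "w * v = 1" "\<alpha> * \<beta> = 1" "u * c = b"
    using nz by (simp_all add: v_def \<beta>_def c_def b_def)
  have cT: "q * c = t3 * t4 * t5" "q * b = u * (t3 * t4 * t5)"
    using q0 by (simp_all add: c_def b_def)
  have nzM: "1 - t3 * w \<noteq> 0" "1 - t4 * w \<noteq> 0" "1 - t5 * w \<noteq> 0" "1 - u * w \<noteq> 0"
    "1 - \<alpha> * v \<noteq> 0" "1 - \<beta> * v \<noteq> 0" "1 - b * \<alpha> * w \<noteq> 0" "1 - b * \<beta> * w \<noteq> 0"
    using P unfolding vb P_Q by auto
  have qw: "t * (q * w) = q * (t * w)" "q * (\<alpha> / (q * w)) = \<alpha> * v" "q * (1 / (\<alpha> * (q * w))) = \<beta> * v" for t
    using nz q0 by (simp_all add: v_def \<beta>_def)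
  have kernel_b: "jackson_kernel x \<alpha> t3 t4 t5 u w = th (x * w) * th (x / w) * (1 - b * w\<^sup>2) * P (u * t4 * t5 * w) * P (u * t3 * t5 * w)
       * P (u * t3 * t4 * w) * P (t3 * t4 * t5 * w) /
     (P (t3 * w) * P (t4 * w) * P (t5 * w) * P (u * w) * P (\<alpha> * v) * P (\<beta> * v)
       * P (b * \<alpha> * w) * P (b * \<beta> * w))"
    unfolding jackson_kernel_def Let_def b_def[symmetric] vb ..
  have e1: "jackson_kernel x \<alpha> t3 t4 t5 u w = N * ((1 - b * w\<^sup>2) * (1 - u * t4 * t5 * w) * (1 - u * t3 * t5 * w) * (1 - u * t3 * t4 * w))"
    unfolding kernel_b P_Q[of "u * t4 * t5 * w"] P_Q[of "u * t3 * t5 * w"] P_Q[of "u * t3 * t4 * w"]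
      P_Q[of "t3 * w"] P_Q[of "t4 * w"] P_Q[of "t5 * w"] P_Q[of "u * w"]
      P_Q[of "\<alpha> * v"] P_Q[of "\<beta> * v"] P_Q[of "b * \<alpha> * w"] P_Q[of "b * \<beta> * w"] N_def M_def
    using nzM by (simp add: mult_ac)
  have e2: "jackson_kernel x \<alpha> t3 t4 t5 (q * u) w = N * ((1 - u * (t3 * t4 * t5) * w\<^sup>2) * (1 - u * w) * (1 - b * \<alpha> * w) * (1 - b * \<beta> * w))"
  proof -
    have "P (q * u * s * t * w) = Q (u * s * t * w)" "P (q * u * w) = Q (u * w)"
      "P (q * b * \<alpha> * w) = Q (b * \<alpha> * w)" "P (q * b / \<alpha> * w) = Q (b * \<beta> * w)" for s t
      by (simp_all add: Q_def \<beta>_def mult_ac)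
    moreover have "q * u * (t3 * t4 * t5 / q) = q * b" by (simp add: b_def)
    ultimately have "jackson_kernel x \<alpha> t3 t4 t5 (q * u) w = th (x * w) * th (x / w) * (1 - q * b * w\<^sup>2)
       * Q (u * t4 * t5 * w) * Q (u * t3 * t5 * w) * Q (u * t3 * t4 * w) * P (t3 * t4 * t5 * w) /
     (P (t3 * w) * P (t4 * w) * P (t5 * w) * Q (u * w) * P (\<alpha> * v) * P (\<beta> * v)
       * Q (b * \<alpha> * w) * Q (b * \<beta> * w))"
      unfolding jackson_kernel_def Let_def vb by presburger
    then show ?thesis
      unfolding P_Q[of "t3 * w"] P_Q[of "t4 * w"] P_Q[of "t5 * w"]
        P_Q[of "\<alpha> * v"] P_Q[of "\<beta> * v"] N_def M_def cT(2)
      using nzM by (simp add: mult_ac)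
  qed
  have e3: "jackson_telescoper x \<alpha> t3 t4 t5 u w = N * ((1 - u * t4 * t5 * w) * (1 - u * t3 * t5 * w) * (1 - u * t3 * t4 * w) * (1 - c * w)
         * (u * w * (1 - b * u * w)) * (1 - \<alpha> * v) * (1 - \<beta> * v))"
  proof -
    have "P (c * w) = (1 - c * w) * P (t3 * t4 * t5 * w)"
      unfolding P_eq_mult_P_q[of "c * w"] by (simp add: cT(1) flip: mult.assoc)
    then have "jackson_telescoper x \<alpha> t3 t4 t5 u w = th (x * w) * th (x / w) * P (u * t4 * t5 * w) * P (u * t3 * t5 * w) * P (u * t3 * t4 * w)
       * ((1 - c * w) * P (t3 * t4 * t5 * w)) * (u * w * (1 - b * u * w)) /
     (P (t3 * w) * P (t4 * w) * P (t5 * w) * P (u * w) * Q (\<alpha> * v) * Q (\<beta> * v)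
       * P (b * \<alpha> * w) * P (b * \<beta> * w))"
      unfolding jackson_telescoper_def Let_def b_def[symmetric] c_def[symmetric] vb Q_def by argo
    then show ?thesis
      unfolding P_Q[of "u * t4 * t5 * w"] P_Q[of "u * t3 * t5 * w"] P_Q[of "u * t3 * t4 * w"]
      P_Q[of "t3 * w"] P_Q[of "t4 * w"] P_Q[of "t5 * w"] P_Q[of "u * w"]
      P_Q[of "b * \<alpha> * w"] P_Q[of "b * \<beta> * w"] N_def M_def
      using nzM by (simp add: mult_ac)
  qed
  have e4: "jackson_telescoper x \<alpha> t3 t4 t5 u (q * w) = N * ((1 - t3 * w) * (1 - t4 * w) * (1 - t5 * w) * (1 - u * w) * (1 - b * \<alpha> * w) * (1 - b * \<beta> * w)
         * (u * v * (1 - u\<^sup>2 * (t3 * t4 * t5) * w)))"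
  proof -
    have 1: "b / \<alpha> * (q * w) = q * (b * \<beta> * w)" "P (c * (q * w)) = P (t3 * t4 * t5 * w)"
      unfolding cT(1)[symmetric] by (simp_all add: \<beta>_def mult_ac)
    have 2: "u * (q * w) * (1 - b * u * (q * w)) = q * w\<^sup>2 * (u * v * (1 - u\<^sup>2 * (t3 * t4 * t5) * w))"
    proof -
      have "b * u * (q * w) = u\<^sup>2 * (t3 * t4 * t5) * w"
        using cT(2) by algebra
      then show ?thesis using vb(4) by algebra
    qed
    have "jackson_telescoper x \<alpha> t3 t4 t5 u (q * w) = (th (x * w) * th (x / w) / (q * w\<^sup>2)) * Q (u * t4 * t5 * w) * Q (u * t3 * t5 * w) * Q (u * t3 * t4 * w)
       * P (t3 * t4 * t5 * w) * (q * w\<^sup>2 * (u * v * (1 - u\<^sup>2 * (t3 * t4 * t5) * w))) /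
     (Q (t3 * w) * Q (t4 * w) * Q (t5 * w) * Q (u * w) * P (\<alpha> * v) * P (\<beta> * v)
       * Q (b * \<alpha> * w) * Q (b * \<beta> * w))"
      unfolding jackson_telescoper_def Let_def c_def[symmetric] vb(6) 2
      unfolding th_product_shift[OF nz(1,3)] 1 qw(2,3) unfolding qw(1) Q_def[symmetric] ..
    also have "\<dots> = th (x * w) * th (x / w) * Q (u * t4 * t5 * w) * Q (u * t3 * t5 * w) * Q (u * t3 * t4 * w)
       * P (t3 * t4 * t5 * w) * (u * v * (1 - u\<^sup>2 * (t3 * t4 * t5) * w)) /
     (Q (t3 * w) * Q (t4 * w) * Q (t5 * w) * Q (u * w) * P (\<alpha> * v) * P (\<beta> * v)
       * Q (b * \<alpha> * w) * Q (b * \<beta> * w))"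
      using nz q0 by simp
    finally show ?thesis
      unfolding P_Q[of "\<alpha> * v"] P_Q[of "\<beta> * v"] N_def M_def
      using nzM by (simp add: mult_ac)
  qed
  have scale: "A * (N * p1) - B * (N * p2) = N * p3 - N * p4" if "A * p1 - B * p2 = p3 - p4"
    for A B p1 p2 p3 p4 :: complex
    using arg_cong[OF that, of "(*) N"] by (simp add: algebra_simps)
  have "u / \<alpha> = \<beta> * u"
    by (simp add: \<beta>_def)
  then show ?thesis
    unfolding e1 e2 e3 e4 by (simp only: scale[OF jackson_telescoping_identity[OF vb(4,5,6)]])
qed

end

context separating_circle
begin

lemma continuous_on_jackson_kernel:
  assumes t: "norm t3 * norm w0 < 1" "norm t4 * norm w0 < 1" "norm t5 * norm w0 < 1"
    and s: "norm s * norm w0 < 1" "norm (s * (t3 * t4 * t5 / q) * \<alpha>) * norm w0 < 1"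
      "norm (s * (t3 * t4 * t5 / q) / \<alpha>) * norm w0 < 1"
  shows "continuous_on (sphere 0 (norm w0)) (jackson_kernel x \<alpha> t3 t4 t5 s)"
proof -
  have "P (s * (t3 * t4 * t5 / q) * \<alpha> * w) \<noteq> 0" "P (s * (t3 * t4 * t5 / q) / \<alpha> * w) \<noteq> 0"
    if "w \<in> sphere 0 (norm w0)" for w
  proof -
    have "norm w = norm w0" using \<open>w \<in> _\<close> by simp
    then show "P (s * (t3 * t4 * t5 / q) * \<alpha> * w) \<noteq> 0" "P (s * (t3 * t4 * t5 / q) / \<alpha> * w) \<noteq> 0"
      by (rule P_outer_nonzero[OF s(2)], rule P_outer_nonzero[OF s(3)])
  qed
  moreover have "P (t * w) \<noteq> 0" if "w \<in> sphere 0 (norm w0)" "t \<in> {t3, t4, t5, s}" for w t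
    using that P_outer_nonzero[of t w] t s(1) by auto
  ultimately show ?thesis
    unfolding jackson_kernel_def Let_def
    by (intro continuous_intros ballI) (simp_all add: P_inner_nonzero w_nonzero x0 al0)
qed

lemma circle_integral_jackson_shift:
  fixes t3 t4 t5 u :: complex
  defines "b \<equiv> u * (t3 * t4 * t5 / q)"
  assumes t: "norm t3 * norm w0 < 1" "norm t4 * norm w0 < 1" "norm t5 * norm w0 < 1"
    and u: "norm u * norm w0 < 1" "norm (b * \<alpha>) * norm w0 < 1" "norm (b / \<alpha>) * norm w0 < 1"
  shows "(1 - b) * (1 - \<alpha> * u) * (1 - u / \<alpha>) * circle_integral (jackson_kernel x \<alpha> t3 t4 t5 u) w0
       = (1 - u * t3) * (1 - u * t4) * (1 - u * t5) * circle_integral (jackson_kernel x \<alpha> t3 t4 t5 (q * u)) w0"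
proof -
  define T where "T = {t3, t4, t5, u, b * \<alpha>, b / \<alpha>}"
  \<comment> \<open>The largest modulus of an inner pole of the telescoping function.\<close>
  define r1 where "r1 = norm q * max (norm \<alpha>) (1 / norm \<alpha>)"
  obtain r2 where r2: "norm w0 < r2" "\<And>t. t \<in> T \<Longrightarrow> norm t * r2 < 1"
    using ex_larger_radius[of T "norm w0"] t u by (auto simp: T_def)
  show ?thesis
  proof (rule circle_integral_q_telescope)
    show "0 < r1" using al0 q0 by (simp add: r1_def max_def)
    show "r1 < norm (q * w0)" using al1 al2 q0 by (simp add: r1_def norm_mult)
    show "norm w0 < r2" by fact
    show "jackson_telescoper x \<alpha> t3 t4 t5 u holomorphic_on {w. r1 < norm w \<and> norm w < r2}"
    proof -
      have 1: "P (t * w) \<noteq> 0" if "t \<in> T" "norm w < r2" for t w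
      proof (rule P_nonzero)
        have "norm t * norm w \<le> norm t * r2" using that by (intro mult_left_mono) auto
        then show "norm (t * w) < 1" using r2(2)[OF that(1)] by (simp add: norm_mult)
      qed
      have "P (t3 * w) * P (t4 * w) * P (t5 * w) * P (u * w) * P (q * (\<alpha> / w)) * P (q * (1 / (\<alpha> * w)))
           * P (b * \<alpha> * w) * P (b / \<alpha> * w) \<noteq> 0 \<and> w \<noteq> 0"
        if "r1 < norm w" "norm w < r2" for w
      proof -
        have "\<forall>t\<in>T. P (t * w) \<noteq> 0" using 1 that(2) by blast
        moreover have "P (q * (\<alpha> / w)) \<noteq> 0" "P (q * (1 / (\<alpha> * w))) \<noteq> 0" "w \<noteq> 0"
          using P_inner_nonzero_shifted[OF that(1)[unfolded r1_def]] by blast+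
        ultimately show ?thesis
          unfolding T_def by (simp only: ball_simps mult_eq_0_iff simp_thms)
      qed
      then show ?thesis
        unfolding jackson_telescoper_def Let_def b_def[symmetric]
        by (intro holomorphic_intros) (use al0 x0 q0 in auto)
    qed
    show "(1 - b) * (1 - \<alpha> * u) * (1 - u / \<alpha>) * jackson_kernel x \<alpha> t3 t4 t5 u w
       - (1 - u * t3) * (1 - u * t4) * (1 - u * t5) * jackson_kernel x \<alpha> t3 t4 t5 (q * u) w
       = jackson_telescoper x \<alpha> t3 t4 t5 u w - jackson_telescoper x \<alpha> t3 t4 t5 u (q * w)" if "norm w = norm w0" for w
      unfolding b_def
      using that t u[unfolded b_def] by (intro jackson_kernel_shift x0 al0 w_nonzero P_outer_nonzero P_inner_nonzero)
    show "continuous_on (sphere 0 (norm w0)) (jackson_kernel x \<alpha> t3 t4 t5 u)"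
      using u unfolding b_def by (rule continuous_on_jackson_kernel[OF t])
    have "q * u * (t3 * t4 * t5 / q) * \<alpha> = q * (b * \<alpha>)" "q * u * (t3 * t4 * t5 / q) / \<alpha> = q * (b / \<alpha>)"
      by (simp_all add: b_def)
    then show "continuous_on (sphere 0 (norm w0)) (jackson_kernel x \<alpha> t3 t4 t5 (q * u))"
      by (intro continuous_on_jackson_kernel t) (simp_all only: scaled_small[OF u(1)] scaled_small[OF u(2)] scaled_small[OF u(3)])
  qed
qed

text \<open>
  As for the Saalschuetz integral, but the admissible \<open>u\<close> are now those for which also the two
  parameters \<open>b \<alpha>\<close> and \<open>b / \<alpha>\<close>, proportional to \<open>u\<close>, stay small enough.
\<close>

lemma circle_integral_jackson_to_saalschuetz:
  fixes t3 t4 t5 u :: complex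
  defines "b \<equiv> u * (t3 * t4 * t5 / q)"
  assumes t: "norm t3 * norm w0 < 1" "norm t4 * norm w0 < 1" "norm t5 * norm w0 < 1"
    and u: "norm u * norm w0 < 1" "norm (b * \<alpha>) * norm w0 < 1" "norm (b / \<alpha>) * norm w0 < 1"
  shows "circle_integral (jackson_kernel x \<alpha> t3 t4 t5 u) w0
       = P (u * t3) * P (u * t4) * P (u * t5) / (P b * P (\<alpha> * u) * P (u / \<alpha>)) * circle_integral (saalschuetz_kernel x \<alpha> t3 t4 t5) w0"
proof -
  define D where "D = t3 * t4 * t5 / q"
  define J where "J s = circle_integral (jackson_kernel x \<alpha> t3 t4 t5 s) w0 * P (s * D) * P (\<alpha> * s) * P (s / \<alpha>)
      / (P (s * t3) * P (s * t4) * P (s * t5))" for s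
  define U where "U = {s :: complex. norm s * norm w0 < 1 \<and> norm (s * D * \<alpha>) * norm w0 < 1
      \<and> norm (s * D / \<alpha>) * norm w0 < 1}"
  have nz: "P (s * t3) \<noteq> 0 \<and> P (s * t4) \<noteq> 0 \<and> P (s * t5) \<noteq> 0 \<and> P (s * D) \<noteq> 0 \<and> P (\<alpha> * s) \<noteq> 0 \<and> P (s / \<alpha>) \<noteq> 0"
    if "s \<in> U" for s
  proof -
    have s: "norm s * norm w0 < 1" "norm (s * D * \<alpha>) * norm w0 < 1" using that by (auto simp: U_def)
    have "norm (s * D) < 1" using al_product_lt_1(2)[OF s(2)] al0 by simp
    then show ?thesis
      using product_lt_1[OF s(1) t(1)] product_lt_1[OF s(1) t(2)] product_lt_1[OF s(1) t(3)] al_product_lt_1[OF s(1)]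
      by (simp add: P_nonzero)
  qed
  have uU: "u \<in> U" using u by (simp add: U_def b_def D_def)
  have "J u = J 0"
  proof (rule eq_at_zero_if_invariant_under_contraction[OF q1, of U])
    show "open U" unfolding U_def by (intro open_Collect_conj open_Collect_less continuous_intros) (use al0 in auto)
    show "0 \<in> U" by (simp add: U_def)
    show "q * s \<in> U" if "s \<in> U" for s
      using that scaled_small[of s] scaled_small[of "s * D * \<alpha>"] scaled_small[of "s * D / \<alpha>"]
      by (simp add: U_def mult_ac)
    show "continuous_on U J"
    proof -
      have "continuous_on U (\<lambda>s. circle_integral (jackson_kernel x \<alpha> t3 t4 t5 s) w0)"
      proof (rule continuous_on_circle_integral)
        have "P (s * D * \<alpha> * w) \<noteq> 0 \<and> P (s * D / \<alpha> * w) \<noteq> 0 \<and> P (s * w) \<noteq> 0"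
          if "s \<in> U" "norm w = norm w0" for s w
          using that(1) unfolding U_def by (auto simp only: mem_Collect_eq intro!: P_outer_nonzero[OF _ that(2)])
        moreover have "P (t3 * w) \<noteq> 0 \<and> P (t4 * w) \<noteq> 0 \<and> P (t5 * w) \<noteq> 0" if "norm w = norm w0" for w
          using that P_outer_nonzero[of _ w] t by auto
        moreover have "w0 \<noteq> 0" using w0_gt_1 by auto
        ultimately show "continuous_on (U \<times> {-pi..pi}) (\<lambda>(s, \<psi>). jackson_kernel x \<alpha> t3 t4 t5 s (w0 * cis \<psi>))"
          unfolding split_def jackson_kernel_def Let_def D_def[symmetric]
          by (intro continuous_intros ballI) (auto simp: P_inner_nonzero x0 al0 norm_mult)
      qed
      then show ?thesis unfolding J_def by (intro continuous_intros ballI) (use nz al0 in auto)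
    qed
    show "J (q * s) = J s" if s: "s \<in> U" for s
    proof -
      define C where "C = circle_integral (jackson_kernel x \<alpha> t3 t4 t5 (q * s)) w0"
      define E where "E = circle_integral (jackson_kernel x \<alpha> t3 t4 t5 s) w0"
      have *: "(1 - s * D) * (1 - \<alpha> * s) * (1 - s / \<alpha>) * E = (1 - s * t3) * (1 - s * t4) * (1 - s * t5) * C"
        unfolding C_def E_def D_def by (rule circle_integral_jackson_shift[OF t]) (use s in \<open>simp_all add: U_def D_def\<close>)
      have r: "P (s * D) = (1 - s * D) * P (q * s * D)" "P (\<alpha> * s) = (1 - \<alpha> * s) * P (\<alpha> * (q * s))"
        "P (s / \<alpha>) = (1 - s / \<alpha>) * P (q * s / \<alpha>)" "P (s * t3) = (1 - s * t3) * P (q * s * t3)"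
        "P (s * t4) = (1 - s * t4) * P (q * s * t4)" "P (s * t5) = (1 - s * t5) * P (q * s * t5)"
        using P_eq_mult_P_q[of "s * D"] P_eq_mult_P_q[of "\<alpha> * s"] P_eq_mult_P_q[of "s / \<alpha>"] P_eq_mult_P_q[of "s * t3"] P_eq_mult_P_q[of "s * t4"] P_eq_mult_P_q[of "s * t5"]
        by (simp_all add: mult_ac)
      have nz': "1 - s * t3 \<noteq> 0" "1 - s * t4 \<noteq> 0" "1 - s * t5 \<noteq> 0" using nz[OF s] r by auto
      have "C = (1 - s * D) * (1 - \<alpha> * s) * (1 - s / \<alpha>) * E / ((1 - s * t3) * (1 - s * t4) * (1 - s * t5))"
        by (intro eq_divide_imp) (use * nz' in \<open>simp_all add: mult_ac\<close>)
      then show ?thesis unfolding J_def C_def[symmetric] E_def[symmetric] r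
        by (simp add: mult_ac)
    qed
  qed (rule uU)
  moreover have "jackson_kernel x \<alpha> t3 t4 t5 0 = saalschuetz_kernel x \<alpha> t3 t4 t5"
    by (simp add: jackson_kernel_def saalschuetz_kernel_def fun_eq_iff)
  ultimately have J_u: "circle_integral (jackson_kernel x \<alpha> t3 t4 t5 u) w0 * P b * P (\<alpha> * u) * P (u / \<alpha>)
      / (P (u * t3) * P (u * t4) * P (u * t5)) = circle_integral (saalschuetz_kernel x \<alpha> t3 t4 t5) w0"
    by (simp add: J_def D_def b_def)
  have solve: "X = r1 * r2 * r3 / (p1 * p2 * p3) * Y"
    if "X * p1 * p2 * p3 / (r1 * r2 * r3) = Y" "r1 \<noteq> 0 \<and> r2 \<noteq> 0 \<and> r3 \<noteq> 0 \<and> p1 \<noteq> 0 \<and> p2 \<noteq> 0 \<and> p3 \<noteq> 0"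
    for X Y r1 r2 r3 p1 p2 p3 :: complex
    using that by (auto simp: field_simps)
  show ?thesis
    by (rule solve[OF J_u]) (use nz[OF uU] in \<open>simp add: D_def b_def\<close>)
qed

theorem circle_integral_jackson:
  fixes t3 t4 t5 u :: complex
  defines "b \<equiv> u * (t3 * t4 * t5 / q)"
  assumes t: "norm t3 * norm w0 < 1" "norm t4 * norm w0 < 1" "norm t5 * norm w0 < 1"
    and u: "norm u * norm w0 < 1" "norm (b * \<alpha>) * norm w0 < 1" "norm (b / \<alpha>) * norm w0 < 1"
  shows "circle_integral (jackson_kernel x \<alpha> t3 t4 t5 u) w0
       = 2 * of_real pi * (th (x * \<alpha>) * th (x / \<alpha>)
         * (P (u * t3) * P (u * t4) * P (u * t5) * P (t3 * t4) * P (t3 * t5) * P (t4 * t5))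
         / (P q * P b * P (\<alpha> * u) * P (u / \<alpha>) * P (\<alpha> * t3) * P (t3 / \<alpha>) * P (\<alpha> * t4) * P (t4 / \<alpha>)
            * P (\<alpha> * t5) * P (t5 / \<alpha>)))"
  using circle_integral_jackson_to_saalschuetz[OF t u[unfolded b_def]] circle_integral_saalschuetz[OF t] circle_integral_theta[OF separating_circle_axioms]
  by (simp add: b_def mult_ac)

end

section \<open>The integral with a free theta parameter\<close>

theorem theorem7p1:
  fixes q a b c d e h ra rb :: complex and \<sigma> :: real
    and num1 num2 den1 den2 :: "complex list"
  defines "num1 \<equiv> [h * (ra / rb), q / h * (rb / ra)]"
    and "num2 \<equiv> [h * (ra / rb), q / h * (rb / ra), rb, - rb,
                 q / c * (ra * rb), q / d * (ra * rb), q / e * (ra * rb),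
                 (rb / ra) ^ 3 * c * d * e]"
    and "den1 \<equiv> [ra / rb, rb / ra]"
    and "den2 \<equiv> [q * rb, - (q * rb), ra * rb, c * (rb / ra), d * (rb / ra), e * (rb / ra),
                 rb ^ 3 / ra, q * ra ^ 3 / (c * d * e * rb)]"
  assumes nonzero: "q \<noteq> 0" "a \<noteq> 0" "b \<noteq> 0" "c \<noteq> 0" "d \<noteq> 0" "e \<noteq> 0" "h \<noteq> 0"
    and "norm q < 1"
    and "\<sigma> > 0"
    and sqrt_a: "ra ^ 2 = a" and sqrt_b: "rb ^ 2 = b"
    and "h \<notin> range (\<lambda>k::int. q powi k)"
    and "h * (ra / rb) \<notin> range (\<lambda>k::int. q powi k)"
    and den_integrand: "\<forall>\<psi>\<in>{-pi..pi}.
          qpochs_inf (scaled den1 (of_real \<sigma> / cis \<psi>) @ scaled den2 (cis \<psi> / of_real \<sigma>)) q \<noteq> 0"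
    and den_rhs: "qpochs_inf [q, q * a / c, b * c / a, b * d / a, b * e / a, b, c, d, e,
          q * a / (c * d * e), q * a ^ 2 / (b * c * d * e)] q \<noteq> 0"
    and "\<forall>\<gamma>\<in>set den1. norm (of_real \<sigma> * \<gamma>) < 1"
    and "\<forall>\<gamma>\<in>set den2. norm \<gamma> / \<sigma> < 1"
  shows "((\<lambda>\<psi>.
            qpochs_inf (scaled num1 (of_real \<sigma> / cis \<psi>) @ scaled num2 (cis \<psi> / of_real \<sigma>)) q
          / qpochs_inf (scaled den1 (of_real \<sigma> / cis \<psi>) @ scaled den2 (cis \<psi> / of_real \<sigma>)) q)
         has_integral
          2 * of_real pi *
          (qthetas [h, h * (a / b)] q
           * qpochs_inf [q * a / c, q * a / (c * d), q * a / (c * e), q * a / (d * e),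
                         b * c * d / a, b * c * e / a, b * d * e / a] q
           / qpochs_inf [q, q * a / c, b * c / a, b * d / a, b * e / a, b, c, d, e,
                         q * a / (c * d * e), q * a ^ 2 / (b * c * d * e)] q))
         {-pi..pi}"
proof -
  define \<alpha> where "\<alpha> = ra / rb"
  define w0 where "w0 = complex_of_real (1 / \<sigma>)"
  define t3 where "t3 = c / \<alpha>"
  define t4 where "t4 = d / \<alpha>"
  define t5 where "t5 = e / \<alpha>"
  define u where "u = q * b / (t3 * t4 * t5)"
  define x where "x = h * \<alpha>"
  have \<sigma>: "\<sigma> > 0" by fact
  have r0: "ra \<noteq> 0" "rb \<noteq> 0" using nonzero sqrt_a sqrt_b by auto
  have al0: "\<alpha> \<noteq> 0" using r0 by (simp add: \<alpha>_def)
  have t0: "t3 \<noteq> 0" "t4 \<noteq> 0" "t5 \<noteq> 0" using nonzero al0 by (simp_all add: t3_def t4_def t5_def)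
  have ra: "ra = \<alpha> * rb" using r0 by (simp add: \<alpha>_def)
  have a: "a = \<alpha>\<^sup>2 * b" unfolding sqrt_a[symmetric] sqrt_b[symmetric] ra by (simp add: power_mult_distrib)
  have b: "u * (t3 * t4 * t5 / q) = b" using t0 nonzero by (simp add: u_def)
  have cde: "c = \<alpha> * t3" "d = \<alpha> * t4" "e = \<alpha> * t5" using al0 by (simp_all add: t3_def t4_def t5_def)
  have b_sq: "rb\<^sup>2 = b" by fact
  have den2_eq: "den2 = [q * rb, - (q * rb), b * \<alpha>, t3, t4, t5, b / \<alpha>, u]"
    unfolding den2_def ra u_def cde b_sq[symmetric] using al0 r0 t0
    by (simp add: field_simps power2_eq_square power3_eq_cube)
  have num2_eq: "num2 = [x, q / x, rb, - rb, u * t4 * t5, u * t3 * t5, u * t3 * t4, t3 * t4 * t5]"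
    unfolding num2_def ra u_def cde b_sq[symmetric] x_def using al0 r0 t0 nonzero
    by (simp add: field_simps power2_eq_square power3_eq_cube)
  have num1_eq: "num1 = [x, q / x]"
    unfolding num1_def ra x_def using al0 r0 nonzero by simp
  have den1_eq: "den1 = [\<alpha>, 1 / \<alpha>]"
    unfolding den1_def \<alpha>_def by simp
  have small: "norm t * norm w0 < 1" if "t \<in> set den2" for t
    using that \<open>\<forall>\<gamma>\<in>set den2. norm \<gamma> / \<sigma> < 1\<close> \<sigma> by (simp add: w0_def norm_divide)
  interpret separating_circle q x \<alpha> w0
  proof
    have "\<sigma> * norm t < 1" if "t \<in> set den1" for t
      using that \<open>\<forall>\<gamma>\<in>set den1. norm (of_real \<sigma> * \<gamma>) < 1\<close> \<sigma> by (simp add: norm_mult)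
    from this[of \<alpha>] this[of "1 / \<alpha>"] show "norm \<alpha> < norm w0" "1 / norm \<alpha> < norm w0"
      using \<sigma> by (simp_all add: den1_eq w0_def norm_divide field_simps)
  qed (use nonzero al0 \<open>norm q < 1\<close> in \<open>auto simp: x_def\<close>)
  have t: "norm t3 * norm w0 < 1" "norm t4 * norm w0 < 1" "norm t5 * norm w0 < 1"
    and u: "norm u * norm w0 < 1" "norm (b * \<alpha>) * norm w0 < 1" "norm (b / \<alpha>) * norm w0 < 1"
    and rb: "norm (q * rb) * norm w0 < 1" "norm (- (q * rb)) * norm w0 < 1"
    by (intro small; simp add: den2_eq)+
  define f where "f \<psi> = qpochs_inf (scaled num1 (of_real \<sigma> / cis \<psi>) @ scaled num2 (cis \<psi> / of_real \<sigma>)) q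
          / qpochs_inf (scaled den1 (of_real \<sigma> / cis \<psi>) @ scaled den2 (cis \<psi> / of_real \<sigma>)) q" for \<psi>
  have f_eq: "f \<psi> = jackson_kernel x \<alpha> t3 t4 t5 u (w0 * cis \<psi>)" for \<psi>
  proof -
    define w where "w = w0 * cis \<psi>"
    have w: "norm w = norm w0" by (simp add: w_def norm_mult)
    have w_eq: "cis \<psi> / of_real \<sigma> = w" "of_real \<sigma> / cis \<psi> = 1 / w"
      using \<sigma> by (simp_all add: w_def w0_def)
    \<comment> \<open>The pairs \<open>\<plusminus> rb\<close> and \<open>\<plusminus> q rb\<close> leave only the very-well-poised factor \<open>1 - b w\<^sup>2\<close>.\<close>
    have A: "P (rb * w) = (1 - rb * w) * P (q * rb * w)" "P (- rb * w) = (1 + rb * w) * P (- (q * rb) * w)"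
      using P_eq_mult_P_q[of "rb * w"] P_eq_mult_P_q[of "- rb * w"] by (simp_all add: mult_ac)
    have B: "P (q * rb * w) \<noteq> 0" "P (- (q * rb) * w) \<noteq> 0"
      by (rule P_outer_nonzero[OF rb(1) w], rule P_outer_nonzero[OF rb(2) w])
    have C: "1 - b * w\<^sup>2 = (1 - rb * w) * (1 + rb * w)"
      by (simp add: b_sq[symmetric] algebra_simps power2_eq_square)
    have key: "n1 * (n2 * (n3 * (n4 * ((1 - r) * B1 * ((1 + r) * B2 * (p1 * (p2 * (p3 * p4))))))))
          / (d1 * (d2 * (B1 * (B2 * (d3 * (e3 * (e4 * (e5 * (d4 * d5)))))))))
        = n3 * n2 * (n1 * n4) * ((1 - r) * (1 + r)) * p1 * p2 * p3 * p4 / (e3 * e4 * e5 * d5 * d1 * d2 * d3 * d4)"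
      if "B1 \<noteq> 0" "B2 \<noteq> 0"
      for n1 n2 n3 n4 r B1 B2 p1 p2 p3 p4 d1 d2 d3 d4 d5 e3 e4 e5 :: complex
      using that by (simp add: mult_ac)
    have D: "th (x * w) = P (x * w) * P (q / x * (1 / w))" "th (x / w) = P (x * (1 / w)) * P (q / x * w)"
      "P (\<alpha> / w) = P (\<alpha> * (1 / w))" "P (1 / (\<alpha> * w)) = P (1 / \<alpha> * (1 / w))"
      by (simp_all add: th_eq)
    show ?thesis
      unfolding f_def w_eq num1_eq num2_eq den1_eq den2_eq scaled_def qpochs_inf_def list.map
        append_Cons append_Nil prod_list.Cons prod_list.Nil mult_1_right A
        jackson_kernel_def Let_def b C D w_def[symmetric]
      by (rule key[OF B])
  qed
  then have f_fun: "f = (\<lambda>\<psi>. jackson_kernel x \<alpha> t3 t4 t5 u (w0 * cis \<psi>))" by blast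
  have "continuous_on {-pi..pi} (\<lambda>\<psi>. jackson_kernel x \<alpha> t3 t4 t5 u (w0 * cis \<psi>))"
    by (rule continuous_on_compose2[OF continuous_on_jackson_kernel[OF t u[folded b]]])
       (auto intro!: continuous_intros simp: norm_mult)
  then have "(f has_integral circle_integral (jackson_kernel x \<alpha> t3 t4 t5 u) w0) {-pi..pi}"
    unfolding circle_integral_def f_fun by (intro integrable_integral integrable_continuous_real)
  also have "circle_integral (jackson_kernel x \<alpha> t3 t4 t5 u) w0 = 2 * of_real pi *
          (qthetas [h, h * (a / b)] q
           * qpochs_inf [q * a / c, q * a / (c * d), q * a / (c * e), q * a / (d * e),
                         b * c * d / a, b * c * e / a, b * d * e / a] q
           / qpochs_inf [q, q * a / c, b * c / a, b * d / a, b * e / a, b, c, d, e,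
                         q * a / (c * d * e), q * a ^ 2 / (b * c * d * e)] q)"
  proof -
    have E: "q * a / (c * d) = u * t5" "q * a / (c * e) = u * t4" "q * a / (d * e) = u * t3"
      "b * c * d / a = t3 * t4" "b * c * e / a = t3 * t5" "b * d * e / a = t4 * t5"
      "b * c / a = t3 / \<alpha>" "b * d / a = t4 / \<alpha>" "b * e / a = t5 / \<alpha>"
      "q * a / (c * d * e) = u / \<alpha>" "q * a\<^sup>2 / (b * c * d * e) = \<alpha> * u"
      "h * (a / b) = x * \<alpha>"
      unfolding a u_def cde x_def using al0 t0 nonzero
      by (simp_all add: field_simps power2_eq_square)
    have "P (q * a / c) \<noteq> 0" using den_rhs by (simp add: qpochs_inf_def)
    moreover have "th h = th (x / \<alpha>)" using al0 by (simp add: x_def)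
    moreover have "P c = P (\<alpha> * t3)" "P d = P (\<alpha> * t4)" "P e = P (\<alpha> * t5)" by (simp_all add: cde)
    ultimately show ?thesis
      unfolding circle_integral_jackson[OF t u[folded b], unfolded b] E(1-12) qthetas_def qpochs_inf_def list.map
        prod_list.Cons prod_list.Nil mult_1_right
      by (simp add: mult_ac)
  qed
  finally show ?thesis by (simp add: f_def)
qed

end
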